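(* There exist a heterogeneous network and a corresponding homogeneous network (i.e. the complete homogeneous network with the same number of nodes $M$, external rate $p=\frac1M\sum_{i=1}^M p_i$ at each node, and internal rates $\frac{q}{M-1}$ with $q=\frac1M\sum_{i}\sum_{j\ne i}q_{i,j}$, where $p_i$, $q_{i,j}$ are the rates of the heterogeneous network) for which $f^{\rm het}(t)-f^{\rm hom}(t)$ changes its sign in $0<t<\infty$, where $f^{\rm het}$ and $f^{\rm hom}$ are the expected fractions of adopters in the two networks.
   Context: Discrete Bass model: a network has $M$ nodes, external rates $p_j\ge 0$ and internal rates $q_{i,j}\ge 0$ ($i\ne j$; the influence of $i$ on $j$). $X_j(t)\in\{0,1\}$ is the state of node $j$ ($1$ = adopter), $X_j(0)=0$ for all $j$. The process $(X_1,\dots,X_M)$ is a continuous-time Markov chain in which adopters remain adopters forever, and each nonadopter $j$ becomes an adopter at rate $p_j+\sum_{k\ne j}q_{k,j}X_k(t)$ (one node changes at a time). The expected fraction of adopters is $f(t)=\frac1M\,\mathbf{E}\big[\sum_{j=1}^M X_j(t)\big]$. "Changes its sign" means that it takes both strictly positive and strictly negative values. *)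

theory Defs
  imports "HOL-Probability.Probability"
begin

text \<open>
  A network consists of the nodes \<open>{1..M}\<close>, the external rates \<open>p j\<close> and the internal rates
  \<open>q i j\<close> (the influence of \<open>i\<close> on \<open>j\<close>). The values of \<open>p\<close> outside \<open>{1..M}\<close>, and those of \<open>q\<close>
  outside \<open>{1..M} \<times> {1..M}\<close> and on the diagonal, are never used. The bound \<open>2 \<le> M\<close> is needed for
  the internal rates of the corresponding homogeneous network to make sense.
\<close>

definition bass_network :: "nat \<Rightarrow> (nat \<Rightarrow> real) \<Rightarrow> (nat \<Rightarrow> nat \<Rightarrow> real) \<Rightarrow> bool" where
  "bass_network M p q \<longleftrightarrow>
     2 \<le> M \<and> (\<forall>j\<in>{1..M}. 0 \<le> p j) \<and> (\<forall>i\<in>{1..M}. \<forall>j\<in>{1..M} - {i}. 0 \<le> q i j)"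

definition homogeneous :: "nat \<Rightarrow> (nat \<Rightarrow> real) \<Rightarrow> (nat \<Rightarrow> nat \<Rightarrow> real) \<Rightarrow> bool" where
  "homogeneous M p q \<longleftrightarrow>
     (\<exists>a. \<forall>j\<in>{1..M}. p j = a) \<and> (\<exists>b. \<forall>i\<in>{1..M}. \<forall>j\<in>{1..M} - {i}. q i j = b)"

definition hom_p :: "nat \<Rightarrow> (nat \<Rightarrow> real) \<Rightarrow> nat \<Rightarrow> real" where
  "hom_p M p = (\<lambda>j. (\<Sum>i\<in>{1..M}. p i) / real M)"

definition hom_q :: "nat \<Rightarrow> (nat \<Rightarrow> nat \<Rightarrow> real) \<Rightarrow> nat \<Rightarrow> nat \<Rightarrow> real" where
  "hom_q M q =
     (\<lambda>i j. ((\<Sum>k\<in>{1..M}. \<Sum>l\<in>{1..M} - {k}. q k l) / real M) / (real M - 1))"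

definition configs :: "nat \<Rightarrow> (nat \<Rightarrow> nat) set" where
  "configs M = {1..M} \<rightarrow>\<^sub>E {0, 1}"

definition adoption_rate ::
  "nat \<Rightarrow> (nat \<Rightarrow> real) \<Rightarrow> (nat \<Rightarrow> nat \<Rightarrow> real) \<Rightarrow> (nat \<Rightarrow> nat) \<Rightarrow> nat \<Rightarrow> real" where
  "adoption_rate M p q s j = p j + (\<Sum>k\<in>{1..M} - {j}. q k j * real (s k))"

text \<open>
  The off-diagonal entries of the generator. At most one summand is nonzero: the one for the node
  \<open>j\<close> whose adoption turns \<open>s\<close> into \<open>s'\<close>.
\<close>

definition transition_rate ::
  "nat \<Rightarrow> (nat \<Rightarrow> real) \<Rightarrow> (nat \<Rightarrow> nat \<Rightarrow> real) \<Rightarrow> (nat \<Rightarrow> nat) \<Rightarrow> (nat \<Rightarrow> nat) \<Rightarrow> real" where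
  "transition_rate M p q s s' =
     (\<Sum>j\<in>{1..M}. if s j = 0 \<and> s' = s(j := 1) then adoption_rate M p q s j else 0)"

definition in_config ::
  "nat \<Rightarrow> (nat \<Rightarrow> real \<Rightarrow> 'w \<Rightarrow> nat) \<Rightarrow> real \<Rightarrow> (nat \<Rightarrow> nat) \<Rightarrow> 'w \<Rightarrow> bool" where
  "in_config M X t s \<omega> \<longleftrightarrow> (\<forall>j\<in>{1..M}. X j t \<omega> = s j)"

text \<open>
  \<open>X j t \<omega>\<close> is the state of node \<open>j\<close> at time \<open>t \<ge> 0\<close>. The last two conditions are the
  infinitesimal description of a continuous-time Markov chain on the finite set of configurations:
  the Markov property, for an arbitrary finite set \<open>T\<close> of past times at which the past
  configurations \<open>\<sigma>\<close> are prescribed, and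
  \<open>P(X(t+h) = s' | X(t) = s) = transition_rate s s' * h + o(h)\<close> as \<open>h \<rightarrow> 0+\<close> for \<open>s \<noteq> s'\<close>. The
  error term has to be uniform in \<open>t\<close>: a merely pointwise version would also admit processes that
  jump with positive probability at a fixed time. Conditional probabilities are only constrained
  where the conditioning event has positive probability.
\<close>

definition bass_process ::
  "'w measure \<Rightarrow> nat \<Rightarrow> (nat \<Rightarrow> real) \<Rightarrow> (nat \<Rightarrow> nat \<Rightarrow> real) \<Rightarrow>
     (nat \<Rightarrow> real \<Rightarrow> 'w \<Rightarrow> nat) \<Rightarrow> bool" where
  "bass_process \<Omega> M p q X \<longleftrightarrow>
     prob_space \<Omega> \<and>
     (\<forall>j\<in>{1..M}. \<forall>t\<ge>0. X j t \<in> \<Omega> \<rightarrow>\<^sub>M count_space UNIV) \<and>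
     (\<forall>j\<in>{1..M}. \<forall>t\<ge>0. \<forall>\<omega>\<in>space \<Omega>. X j t \<omega> \<in> {0, 1}) \<and>
     (\<forall>j\<in>{1..M}. \<forall>\<omega>\<in>space \<Omega>. X j 0 \<omega> = 0) \<and>
     (\<forall>j\<in>{1..M}. \<forall>t\<ge>0. \<forall>u\<ge>t. \<forall>\<omega>\<in>space \<Omega>. X j t \<omega> = 1 \<longrightarrow> X j u \<omega> = 1) \<and>
     (\<forall>T t u \<sigma>. \<forall>s\<in>configs M. \<forall>s'\<in>configs M.
        finite T \<longrightarrow> T \<subseteq> {0..<t} \<longrightarrow> 0 \<le> t \<longrightarrow> t < u \<longrightarrow>
        \<P>(\<omega> in \<Omega>. in_config M X t s \<omega> \<and> (\<forall>r\<in>T. in_config M X r (\<sigma> r) \<omega>)) > 0 \<longrightarrow>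
        \<P>(\<omega> in \<Omega>. in_config M X u s' \<omega> \<bar>
            in_config M X t s \<omega> \<and> (\<forall>r\<in>T. in_config M X r (\<sigma> r) \<omega>))
        = \<P>(\<omega> in \<Omega>. in_config M X u s' \<omega> \<bar> in_config M X t s \<omega>)) \<and>
     (\<forall>s\<in>configs M. \<forall>s'\<in>configs M - {s}.
        uniform_limit {t. 0 \<le> t \<and> \<P>(\<omega> in \<Omega>. in_config M X t s \<omega>) > 0}
          (\<lambda>h t. \<P>(\<omega> in \<Omega>. in_config M X (t + h) s' \<omega> \<bar> in_config M X t s \<omega>) / h)
          (\<lambda>t. transition_rate M p q s s')
          (at_right 0))"

definition adopter_fraction ::
  "'w measure \<Rightarrow> nat \<Rightarrow> (nat \<Rightarrow> real \<Rightarrow> 'w \<Rightarrow> nat) \<Rightarrow> real \<Rightarrow> real" where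
  "adopter_fraction \<Omega> M X t = (1 / real M) * (\<integral>\<omega>. (\<Sum>j\<in>{1..M}. real (X j t \<omega>)) \<partial>\<Omega>)"

definition changes_sign :: "(real \<Rightarrow> real) \<Rightarrow> bool" where
  "changes_sign g \<longleftrightarrow> (\<exists>t>0. g t > 0) \<and> (\<exists>t>0. g t < 0)"

end

(* Two nodes suffice: p = (2, 1), q 1 2 = 5, q 2 1 = 0, so the homogeneous network has p = 3/2 and
   q = 5/2. In both networks the state without adopters is left at rate 3. At first the
   heterogeneous network is ahead, because node 1 is likely to adopt first and then pushes node 2
   strongly. Eventually it is behind, because if node 2 adopts first, node 1 follows only at rate 2,
   whereas the homogeneous network leaves every state but full adoption at
   rate 3 or more.

   The marginals of an arbitrary process are found from the forward equations. Uniformity in t of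
   the infinitesimal description makes the marginals Lipschitz, hence their right derivatives
   continuous, hence two-sided derivatives. A process with the given rates is built from three
   independent variables: the time of the first adoption, a coin for the first adopter, and the
   delay until the second adoption; its Markov property is the lack of memory of the delay. *)

theory Submission
  imports Defs
begin

section \<open>Uniform right difference quotients\<close>

text \<open>Uniformity in the base point bounds all right quotients of short steps at once, so
  \<open>F\<close> is Lipschitz at small scale.\<close>

lemma continuous_on_uniform_right_quotient:
  fixes F G :: "real \<Rightarrow> real"
  assumes lim: "uniform_limit {0..} (\<lambda>h t. (F (t + h) - F t) / h) G (at_right 0)"
    and bound: "\<And>t. 0 \<le> t \<Longrightarrow> \<bar>G t\<bar> \<le> C"
  shows "continuous_on {0..} F"
proof -
  have "C \<ge> 0" using bound[of 0] by simp
  from uniform_limitD[OF lim, of 1] obtain \<delta> where \<delta>: "\<delta> > 0"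
    "\<And>h t. 0 < h \<Longrightarrow> h < \<delta> \<Longrightarrow> 0 \<le> t \<Longrightarrow> \<bar>(F (t + h) - F t) / h - G t\<bar> < 1"
    by (auto simp: eventually_at_right_field dist_real_def)
  have step: "\<bar>F (t + h) - F t\<bar> \<le> (C + 1) * h" if "0 < h" "h < \<delta>" "0 \<le> t" for t h
  proof -
    have "\<bar>(F (t + h) - F t) / h\<bar> \<le> C + 1"
      using \<delta>(2)[OF that] bound[OF that(3)] by linarith
    then show ?thesis
      using that by (simp add: field_simps)
  qed
  \<comment> \<open>Left neighbours need no left quotient: the smaller of the two points serves as
    base point.\<close>
  have lip: "\<bar>F y - F x\<bar> \<le> (C + 1) * \<bar>y - x\<bar>" if "0 \<le> x" "0 \<le> y" "\<bar>y - x\<bar> < \<delta>" for x y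
    using step[of "y - x" x] step[of "x - y" y] that
    by (cases x y rule: linorder_cases) (auto simp: abs_minus_commute)
  show ?thesis
    unfolding continuous_on_iff
  proof (intro ballI allI impI)
    fix x e :: real assume x: "x \<in> {0..}" and e: "e > 0"
    show "\<exists>d>0. \<forall>y\<in>{0..}. dist y x < d \<longrightarrow> dist (F y) (F x) < e"
    proof (intro exI[of _ "min \<delta> (e / (C + 1))"] conjI ballI impI)
      show "min \<delta> (e / (C + 1)) > 0" using \<delta>(1) e \<open>C \<ge> 0\<close> by simp
      fix y :: real assume y: "y \<in> {0..}" and d: "dist y x < min \<delta> (e / (C + 1))"
      have "\<bar>F y - F x\<bar> \<le> (C + 1) * \<bar>y - x\<bar>"
        using lip x y d by (auto simp: dist_real_def)
      also have "\<dots> < (C + 1) * (e / (C + 1))"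
        using d \<open>C \<ge> 0\<close> by (intro mult_strict_left_mono) (auto simp: dist_real_def)
      also have "\<dots> = e" using \<open>C \<ge> 0\<close> by simp
      finally show "dist (F y) (F x) < e" by (simp add: dist_real_def)
    qed
  qed
qed

text \<open>Right quotients converge to \<open>G t\<close> by assumption. A left quotient at
  \<open>t\<close> is a right quotient based at a nearby \<open>y < t\<close>, hence uniformly close
  to \<open>G y\<close>, and continuity of \<open>G\<close> moves this to
  \<open>G t\<close>.\<close>

lemma has_derivative_uniform_right_quotient:
  fixes F G :: "real \<Rightarrow> real"
  assumes lim: "uniform_limit {0..} (\<lambda>h t. (F (t + h) - F t) / h) G (at_right 0)"
    and cont: "continuous_on {0..} G" and t: "0 \<le> t"
  shows "(F has_real_derivative G t) (at t within {0..})"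
  unfolding has_field_derivative_iff Lim_within
proof (intro allI impI)
  fix e :: real assume e: "e > 0"
  from uniform_limitD[OF lim, of "e / 2"] e obtain \<delta> where \<delta>: "\<delta> > 0"
    "\<And>h t. 0 < h \<Longrightarrow> h < \<delta> \<Longrightarrow> 0 \<le> t \<Longrightarrow> \<bar>(F (t + h) - F t) / h - G t\<bar> < e / 2"
    by (auto simp: eventually_at_right_field dist_real_def)
  from cont[unfolded continuous_on_iff, rule_format, of t "e / 2"] t e
  obtain \<eta> where \<eta>: "\<eta> > 0" "\<And>y. 0 \<le> y \<Longrightarrow> \<bar>y - t\<bar> < \<eta> \<Longrightarrow> \<bar>G y - G t\<bar> < e / 2"
    by (auto simp: dist_real_def)
  have "dist ((F y - F t) / (y - t)) (G t) < e"
    if y: "0 \<le> y" "y \<noteq> t" "\<bar>y - t\<bar> < min \<delta> \<eta>" for y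
  proof (cases "y < t")
    case False
    then show ?thesis using \<delta>(2)[of "y - t" t] y t e by (auto simp: dist_real_def)
  next
    case True
    \<comment> \<open>The left quotient at \<open>t\<close> read as the right quotient at
      \<open>y\<close> with step \<open>t - y\<close>.\<close>
    have "(F t - F y) / (t - y) = (F y - F t) / (y - t)"
      using True by (simp add: divide_simps) (simp add: algebra_simps)
    moreover have "\<bar>(F t - F y) / (t - y) - G y\<bar> < e / 2" "\<bar>G y - G t\<bar> < e / 2"
      using \<delta>(2)[of "t - y" y] \<eta>(2)[of y] y True by auto
    ultimately show ?thesis
      unfolding dist_real_def by linarith
  qed
  then show "\<exists>d>0. \<forall>y\<in>{0..}. 0 < dist y t \<and> dist y t < d \<longrightarrow> dist ((F y - F t) / (y - t)) (G t) < e"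
    using \<delta>(1) \<eta>(1) by (intro exI[of _ "min \<delta> \<eta>"]) (auto simp: dist_real_def)
qed

lemma uniform_limit_sum:
  fixes f :: "'i \<Rightarrow> 'a \<Rightarrow> 'b \<Rightarrow> 'c::real_normed_vector"
  assumes "\<And>i. i \<in> I \<Longrightarrow> uniform_limit S (f i) (l i) F"
  shows "uniform_limit S (\<lambda>n x. \<Sum>i\<in>I. f i n x) (\<lambda>x. \<Sum>i\<in>I. l i x) F"
  using assms
proof (induction I rule: infinite_finite_induct)
  case (insert i I)
  then show ?case by (simp add: uniform_limit_add)
qed (simp_all add: uniform_limit_const)

text \<open>The integrating factor \<open>exp (c * t)\<close> turns the difference of two solutions
  into a constant, which is 0 at time 0.\<close>

lemma linear_ode_unique:
  fixes y z f :: "real \<Rightarrow> real"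
  assumes y: "\<And>t. 0 \<le> t \<Longrightarrow> (y has_real_derivative f t - c * y t) (at t within {0..})"
    and z: "\<And>t. 0 \<le> t \<Longrightarrow> (z has_real_derivative f t - c * z t) (at t within {0..})"
    and init: "y 0 = z 0" and t: "0 \<le> t"
  shows "y t = z t"
proof -
  have "((\<lambda>t. exp (c * t) * (y t - z t)) has_real_derivative 0) (at t within {0..})" if "t \<in> {0..}" for t
    using that by (auto intro!: derivative_eq_intros y z simp: algebra_simps)
  from has_field_derivative_zero_constant[OF _ this] obtain k
    where k: "\<And>t. 0 \<le> t \<Longrightarrow> exp (c * t) * (y t - z t) = k" by auto
  show ?thesis using k[of 0] k[OF t] init by simp
qed

section \<open>Forward equations\<close>

lemma finite_configs: "finite (configs M)"
  unfolding configs_def by (intro finite_PiE) auto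

lemma bass_processI:
  assumes "prob_space \<Omega>"
    and "\<And>j t. j \<in> {1..M} \<Longrightarrow> 0 \<le> t \<Longrightarrow> X j t \<in> \<Omega> \<rightarrow>\<^sub>M count_space UNIV"
    and "\<And>j t \<omega>. j \<in> {1..M} \<Longrightarrow> 0 \<le> t \<Longrightarrow> \<omega> \<in> space \<Omega> \<Longrightarrow> X j t \<omega> \<in> {0, 1}"
    and "\<And>j \<omega>. j \<in> {1..M} \<Longrightarrow> \<omega> \<in> space \<Omega> \<Longrightarrow> X j 0 \<omega> = 0"
    and "\<And>j t u \<omega>. j \<in> {1..M} \<Longrightarrow> 0 \<le> t \<Longrightarrow> t \<le> u \<Longrightarrow> \<omega> \<in> space \<Omega> \<Longrightarrow> X j t \<omega> = 1 \<Longrightarrow> X j u \<omega> = 1"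
    and "\<And>T t u \<sigma> s s'. s \<in> configs M \<Longrightarrow> s' \<in> configs M \<Longrightarrow>
      finite T \<Longrightarrow> T \<subseteq> {0..<t} \<Longrightarrow> 0 \<le> t \<Longrightarrow> t < u \<Longrightarrow>
      \<P>(\<omega> in \<Omega>. in_config M X t s \<omega> \<and> (\<forall>r\<in>T. in_config M X r (\<sigma> r) \<omega>)) > 0 \<Longrightarrow>
      \<P>(\<omega> in \<Omega>. in_config M X u s' \<omega> \<bar> in_config M X t s \<omega> \<and> (\<forall>r\<in>T. in_config M X r (\<sigma> r) \<omega>))
      = \<P>(\<omega> in \<Omega>. in_config M X u s' \<omega> \<bar> in_config M X t s \<omega>)"
    and "\<And>s s'. s \<in> configs M \<Longrightarrow> s' \<in> configs M - {s} \<Longrightarrow>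
      uniform_limit {t. 0 \<le> t \<and> \<P>(\<omega> in \<Omega>. in_config M X t s \<omega>) > 0}
        (\<lambda>h t. \<P>(\<omega> in \<Omega>. in_config M X (t + h) s' \<omega> \<bar> in_config M X t s \<omega>) / h)
        (\<lambda>t. transition_rate M p q s s') (at_right 0)"
  shows "bass_process \<Omega> M p q X"
  unfolding bass_process_def
  by (intro conjI ballI allI impI; (rule assms; assumption)?)

locale bass =
  fixes \<Omega> :: "'w measure" and M p q X
  assumes bass_process: "bass_process \<Omega> M p q X"
begin

sublocale prob_space \<Omega>
  using bass_process by (auto simp: bass_process_def)

lemma
  shows X_measurable: "j \<in> {1..M} \<Longrightarrow> 0 \<le> t \<Longrightarrow> X j t \<in> \<Omega> \<rightarrow>\<^sub>M count_space UNIV"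
    and X_values: "j \<in> {1..M} \<Longrightarrow> 0 \<le> t \<Longrightarrow> \<omega> \<in> space \<Omega> \<Longrightarrow> X j t \<omega> \<in> {0, 1}"
    and X_init: "j \<in> {1..M} \<Longrightarrow> \<omega> \<in> space \<Omega> \<Longrightarrow> X j 0 \<omega> = 0"
    and X_mono: "j \<in> {1..M} \<Longrightarrow> 0 \<le> t \<Longrightarrow> t \<le> u \<Longrightarrow> \<omega> \<in> space \<Omega> \<Longrightarrow> X j t \<omega> = 1 \<Longrightarrow> X j u \<omega> = 1"
    and markov: "s \<in> configs M \<Longrightarrow> s' \<in> configs M \<Longrightarrow> finite T \<Longrightarrow> T \<subseteq> {0..<t} \<Longrightarrow> 0 \<le> t \<Longrightarrow> t < u \<Longrightarrow>
      \<P>(\<omega> in \<Omega>. in_config M X t s \<omega> \<and> (\<forall>r\<in>T. in_config M X r (\<sigma> r) \<omega>)) > 0 \<Longrightarrow>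
      \<P>(\<omega> in \<Omega>. in_config M X u s' \<omega> \<bar> in_config M X t s \<omega> \<and> (\<forall>r\<in>T. in_config M X r (\<sigma> r) \<omega>))
      = \<P>(\<omega> in \<Omega>. in_config M X u s' \<omega> \<bar> in_config M X t s \<omega>)"
    and transition_limit: "s \<in> configs M \<Longrightarrow> s' \<in> configs M - {s} \<Longrightarrow>
      uniform_limit {t. 0 \<le> t \<and> \<P>(\<omega> in \<Omega>. in_config M X t s \<omega>) > 0}
        (\<lambda>h t. \<P>(\<omega> in \<Omega>. in_config M X (t + h) s' \<omega> \<bar> in_config M X t s \<omega>) / h)
        (\<lambda>t. transition_rate M p q s s') (at_right 0)"
proof -
  note tail = bass_process[unfolded bass_process_def, THEN conjunct2]
  show "j \<in> {1..M} \<Longrightarrow> 0 \<le> t \<Longrightarrow> X j t \<in> \<Omega> \<rightarrow>\<^sub>M count_space UNIV"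
    by (rule tail[THEN conjunct1, rule_format])
  note tail = tail[THEN conjunct2]
  show "j \<in> {1..M} \<Longrightarrow> 0 \<le> t \<Longrightarrow> \<omega> \<in> space \<Omega> \<Longrightarrow> X j t \<omega> \<in> {0, 1}"
    by (rule tail[THEN conjunct1, rule_format])
  note tail = tail[THEN conjunct2]
  show "j \<in> {1..M} \<Longrightarrow> \<omega> \<in> space \<Omega> \<Longrightarrow> X j 0 \<omega> = 0"
    by (rule tail[THEN conjunct1, rule_format])
  note tail = tail[THEN conjunct2]
  show "j \<in> {1..M} \<Longrightarrow> 0 \<le> t \<Longrightarrow> t \<le> u \<Longrightarrow> \<omega> \<in> space \<Omega> \<Longrightarrow> X j t \<omega> = 1 \<Longrightarrow> X j u \<omega> = 1"
    by (rule tail[THEN conjunct1, rule_format])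
  note tail = tail[THEN conjunct2]
  show "s \<in> configs M \<Longrightarrow> s' \<in> configs M \<Longrightarrow> finite T \<Longrightarrow> T \<subseteq> {0..<t} \<Longrightarrow> 0 \<le> t \<Longrightarrow> t < u \<Longrightarrow>
      \<P>(\<omega> in \<Omega>. in_config M X t s \<omega> \<and> (\<forall>r\<in>T. in_config M X r (\<sigma> r) \<omega>)) > 0 \<Longrightarrow>
      \<P>(\<omega> in \<Omega>. in_config M X u s' \<omega> \<bar> in_config M X t s \<omega> \<and> (\<forall>r\<in>T. in_config M X r (\<sigma> r) \<omega>))
      = \<P>(\<omega> in \<Omega>. in_config M X u s' \<omega> \<bar> in_config M X t s \<omega>)"
    by (rule tail[THEN conjunct1, rule_format])
  show "s \<in> configs M \<Longrightarrow> s' \<in> configs M - {s} \<Longrightarrow>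
      uniform_limit {t. 0 \<le> t \<and> \<P>(\<omega> in \<Omega>. in_config M X t s \<omega>) > 0}
        (\<lambda>h t. \<P>(\<omega> in \<Omega>. in_config M X (t + h) s' \<omega> \<bar> in_config M X t s \<omega>) / h)
        (\<lambda>t. transition_rate M p q s s') (at_right 0)"
    by (rule tail[THEN conjunct2, THEN bspec, THEN bspec])
qed

lemma in_config_measurable [measurable]:
  assumes "0 \<le> t" shows "Measurable.pred \<Omega> (in_config M X t s)"
proof -
  have "Measurable.pred \<Omega> (\<lambda>\<omega>. X j t \<omega> = s j)" if "j \<in> {1..M}" for j
    using X_measurable[OF that assms] by measurable
  then show ?thesis unfolding in_config_def by (intro pred_intros_finite) auto
qed

section \<open>Configuration probabilities at one and at two times\<close>

definition prob_config :: "real \<Rightarrow> (nat \<Rightarrow> nat) \<Rightarrow> real" where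
  "prob_config t s = \<P>(\<omega> in \<Omega>. in_config M X t s \<omega>)"

text \<open>\<open>in_config\<close> looks only at the nodes; uniqueness comes from
  \<open>configs M\<close> consisting of extensional functions, which are fixed off
  \<open>{1..M}\<close>.\<close>

lemma ex1_config:
  assumes "0 \<le> t" "\<omega> \<in> space \<Omega>"
  shows "\<exists>!s. s \<in> configs M \<and> in_config M X t s \<omega>"
proof (rule ex1I[of _ "\<lambda>j\<in>{1..M}. X j t \<omega>"])
  show "(\<lambda>j\<in>{1..M}. X j t \<omega>) \<in> configs M \<and> in_config M X t (\<lambda>j\<in>{1..M}. X j t \<omega>) \<omega>"
    unfolding configs_def in_config_def using X_values[OF _ assms] by simp
next
  fix s assume s: "s \<in> configs M \<and> in_config M X t s \<omega>"
  show "s = (\<lambda>j\<in>{1..M}. X j t \<omega>)"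
  proof
    fix j show "s j = (\<lambda>j\<in>{1..M}. X j t \<omega>) j"
      using s by (cases "j \<in> {1..M}") (auto simp add: configs_def in_config_def PiE_def extensional_def)
  qed
qed

lemma prob_sum_config:
  assumes "0 \<le> t" and [measurable]: "Measurable.pred \<Omega> Q"
  shows "\<P>(\<omega> in \<Omega>. Q \<omega>) = (\<Sum>s\<in>configs M. \<P>(\<omega> in \<Omega>. Q \<omega> \<and> in_config M X t s \<omega>))"
proof -
  note in_config_measurable[OF assms(1), measurable]
  have "{\<omega>\<in>space \<Omega>. Q \<omega>} = (\<Union>s\<in>configs M. {\<omega>\<in>space \<Omega>. Q \<omega> \<and> in_config M X t s \<omega>})"
    using ex1_config[OF assms(1)] by blast
  moreover have "disjoint_family_on (\<lambda>s. {\<omega>\<in>space \<Omega>. Q \<omega> \<and> in_config M X t s \<omega>}) (configs M)"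
    unfolding disjoint_family_on_def using ex1_config[OF assms(1)] by blast
  ultimately show ?thesis
    by (simp add: finite_measure_finite_Union[OF finite_configs] image_subset_iff)
qed

definition transition_prob :: "real \<Rightarrow> real \<Rightarrow> (nat \<Rightarrow> nat) \<Rightarrow> (nat \<Rightarrow> nat) \<Rightarrow> real" where
  "transition_prob t u s s' = \<P>(\<omega> in \<Omega>. in_config M X u s' \<omega> \<bar> in_config M X t s \<omega>)"

text \<open>If \<open>s\<close> has probability 0 at time \<open>t\<close>, the conditional
  probability is a quotient by 0, but then both sides vanish, so the product rule holds without a
  case distinction later.\<close>

lemma prob_config_trans:
  assumes "0 \<le> t"
  shows "\<P>(\<omega> in \<Omega>. in_config M X u s' \<omega> \<and> in_config M X t s \<omega>) = prob_config t s * transition_prob t u s s'"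
proof (cases "prob_config t s = 0")
  case True
  note in_config_measurable[OF assms(1), measurable]
  have "\<P>(\<omega> in \<Omega>. in_config M X u s' \<omega> \<and> in_config M X t s \<omega>) \<le> prob_config t s"
    unfolding prob_config_def by (intro finite_measure_mono) auto
  with True measure_nonneg[of \<Omega> "{\<omega> \<in> space \<Omega>. in_config M X u s' \<omega> \<and> in_config M X t s \<omega>}"]
  have "\<P>(\<omega> in \<Omega>. in_config M X u s' \<omega> \<and> in_config M X t s \<omega>) = 0"
    by linarith
  then show ?thesis by (simp only: True mult_zero_left)
qed (simp only: transition_prob_def cond_prob_def prob_config_def, simp)

text \<open>Rows of the transition matrix sum to 1. The factor \<open>prob_config t s\<close> makes
  this correct for null configurations too, whose rows are 0 by convention.\<close>

lemma trans_sum: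
  assumes "0 \<le> t" "0 \<le> u"
  shows "prob_config t s = prob_config t s * (\<Sum>s'\<in>configs M. transition_prob t u s s')"
proof -
  note in_config_measurable[OF assms(1), measurable]
  have "prob_config t s = (\<Sum>s'\<in>configs M. \<P>(\<omega> in \<Omega>. in_config M X t s \<omega> \<and> in_config M X u s' \<omega>))"
    unfolding prob_config_def by (rule prob_sum_config[OF assms(2)]) simp
  also have "\<dots> = (\<Sum>s'\<in>configs M. prob_config t s * transition_prob t u s s')"
    unfolding prob_config_trans[OF assms(1), symmetric] by (simp only: conj_commute)
  finally show ?thesis by (simp only: sum_distrib_left)
qed

text \<open>The right-hand side of the Kolmogorov forward equation, gain minus loss. The diagonal
  entry of the generator is spread over the loss terms.\<close>

definition prob_flow :: "real \<Rightarrow> (nat \<Rightarrow> nat) \<Rightarrow> real" where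
  "prob_flow t s' = (\<Sum>s\<in>configs M - {s'}.
     prob_config t s * transition_rate M p q s s' - prob_config t s' * transition_rate M p q s' s)"

text \<open>Total probability at time \<open>u\<close>, with the probability of staying in
  \<open>s'\<close> eliminated through the row sum: only off-diagonal rates are prescribed for a
  process.\<close>

lemma prob_config_increment:
  assumes "0 \<le> t" "0 \<le> u" "s' \<in> configs M"
  shows "prob_config u s' - prob_config t s' =
    (\<Sum>s\<in>configs M - {s'}. prob_config t s * transition_prob t u s s' - prob_config t s' * transition_prob t u s' s)"
proof -
  note in_config_measurable[OF assms(2), measurable]
  have "prob_config u s' = (\<Sum>s\<in>configs M. prob_config t s * transition_prob t u s s')"
    unfolding prob_config_def[of u] prob_config_trans[OF assms(1), symmetric]
    by (rule prob_sum_config[OF assms(1)]) simp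
  moreover note trans_sum[OF assms(1,2), of s']
  ultimately show ?thesis
    using sum.remove[OF finite_configs assms(3), of "\<lambda>s. prob_config t s * transition_prob t u s s'"]
      sum.remove[OF finite_configs assms(3), of "transition_prob t u s'"]
    by (simp add: sum_subtractf sum_distrib_left[symmetric] algebra_simps)
qed

text \<open>The process condition is uniform only over times at which \<open>s\<close> has positive
  probability. Weighting by \<open>prob_config t s\<close> extends it to all
  \<open>t \<ge> 0\<close>: the term is 0 at the other times, and a weight of at most 1 does not
  enlarge the error.\<close>

lemma uniform_limit_flow_term:
  assumes "s \<in> configs M" "s' \<in> configs M - {s}"
  shows "uniform_limit {0..} (\<lambda>h t. prob_config t s * transition_prob t (t + h) s s' / h)
    (\<lambda>t. prob_config t s * transition_rate M p q s s') (at_right 0)"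
proof (rule uniform_limitI)
  fix e :: real assume "e > 0"
  from uniform_limitD[OF transition_limit[OF assms, folded transition_prob_def prob_config_def] this]
  show "\<forall>\<^sub>F h in at_right 0. \<forall>t\<in>{0..}. dist (prob_config t s * transition_prob t (t + h) s s' / h)
      (prob_config t s * transition_rate M p q s s') < e"
  proof eventually_elim
    case (elim h)
    show ?case
    proof
      fix t :: real assume t: "t \<in> {0..}"
      have nn: "0 \<le> prob_config t s" "prob_config t s \<le> 1" by (auto simp: prob_config_def)
      show "dist (prob_config t s * transition_prob t (t + h) s s' / h)
          (prob_config t s * transition_rate M p q s s') < e"
      proof (cases "prob_config t s = 0")
        case False
        then have "dist (transition_prob t (t + h) s s' / h) (transition_rate M p q s s') < e"
          using elim t nn by (auto simp: less_le)
        moreover have "dist (prob_config t s * transition_prob t (t + h) s s' / h)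
          (prob_config t s * transition_rate M p q s s')
          = prob_config t s * dist (transition_prob t (t + h) s s' / h) (transition_rate M p q s s')"
          using nn by (simp add: dist_real_def right_diff_distrib[symmetric] abs_mult
              times_divide_eq_right[symmetric] del: times_divide_eq_right)
        ultimately show ?thesis
          using nn mult_left_le_one_le[of "dist (transition_prob t (t + h) s s' / h) (transition_rate M p q s s')" "prob_config t s"]
          by simp
      qed (use \<open>e > 0\<close> in simp)
    qed
  qed
qed

lemma uniform_limit_prob_config:
  assumes "s' \<in> configs M"
  shows "uniform_limit {0..} (\<lambda>h t. (prob_config (t + h) s' - prob_config t s') / h)
    (\<lambda>t. prob_flow t s') (at_right 0)"
proof -
  have "uniform_limit {0..} (\<lambda>h t. \<Sum>s\<in>configs M - {s'}. prob_config t s * transition_prob t (t + h) s s' / h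
      - prob_config t s' * transition_prob t (t + h) s' s / h) (\<lambda>t. prob_flow t s') (at_right 0)"
    unfolding prob_flow_def using assms
    by (intro uniform_limit_sum uniform_limit_minus uniform_limit_flow_term) auto
  moreover have eq: "\<forall>\<^sub>F h in at_right 0. \<forall>t\<in>{0..}. (\<Sum>s\<in>configs M - {s'}. prob_config t s * transition_prob t (t + h) s s' / h
      - prob_config t s' * transition_prob t (t + h) s' s / h) = (prob_config (t + h) s' - prob_config t s') / h"
    using eventually_at_right_less[of 0]
  proof eventually_elim
    case (elim h)
    then show ?case
      using prob_config_increment[OF _ _ assms]
      by (simp add: sum_divide_distrib diff_divide_distrib)
  qed
  ultimately show ?thesis
    by (subst (asm) uniform_limit_cong[OF eq]) auto
qed

text \<open>A bootstrap: the flow is bounded because probabilities are at most 1, so every marginal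
  is continuous; therefore the flow, a linear combination of marginals, is continuous, and the right
  quotients become derivatives.\<close>

lemma forward_equation:
  assumes "s' \<in> configs M" "0 \<le> t"
  shows "((\<lambda>t. prob_config t s') has_real_derivative prob_flow t s') (at t within {0..})"
proof -
  have cont: "continuous_on {0..} (\<lambda>t. prob_config t s)" if s: "s \<in> configs M" for s
  proof (rule continuous_on_uniform_right_quotient[OF uniform_limit_prob_config[OF s]])
    fix t
    show "\<bar>prob_flow t s\<bar> \<le> (\<Sum>s'\<in>configs M - {s}. \<bar>transition_rate M p q s' s\<bar> + \<bar>transition_rate M p q s s'\<bar>)"
      unfolding prob_flow_def
    proof (intro order.trans[OF sum_abs] sum_mono order.trans[OF abs_triangle_ineq4] add_mono)
      have *: "\<bar>prob_config t a * transition_rate M p q a b\<bar> \<le> \<bar>transition_rate M p q a b\<bar>" for a b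
        by (auto simp: abs_mult prob_config_def intro!: mult_left_le_one_le)
      fix s' show "\<bar>prob_config t s' * transition_rate M p q s' s\<bar> \<le> \<bar>transition_rate M p q s' s\<bar>"
        "\<bar>prob_config t s * transition_rate M p q s s'\<bar> \<le> \<bar>transition_rate M p q s s'\<bar>"
        by (rule *)+
    qed
  qed
  have "continuous_on {0..} (\<lambda>t. prob_flow t s')"
    unfolding prob_flow_def using assms(1)
    by (intro continuous_on_sum continuous_on_diff continuous_on_mult cont) auto
  from has_derivative_uniform_right_quotient[OF uniform_limit_prob_config[OF assms(1)] this assms(2)]
  show ?thesis .
qed

end

section \<open>Marginals for two nodes\<close>

text \<open>The restriction to \<open>{1..2}\<close> makes the function extensional, as the elements
  of \<open>configs 2\<close> are.\<close>

definition cfg :: "nat \<Rightarrow> nat \<Rightarrow> nat \<Rightarrow> nat" where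
  "cfg a b = (\<lambda>j\<in>{1..2}. if j = 1 then a else b)"

lemma atLeastAtMost_1_2: "{1..2::nat} = {1, 2}" "{Suc 0..2} = {1, 2}"
  by auto

lemma cfg_1 [simp]: "cfg a b 1 = a" "cfg a b (Suc 0) = a"
  and cfg_2 [simp]: "cfg a b 2 = b"
  by (simp_all add: cfg_def)

lemma cfg_eq_iff [simp]: "cfg a b = cfg a' b' \<longleftrightarrow> a = a' \<and> b = b'"
  by (metis cfg_1(1) cfg_2)

lemma cfg_upd [simp]:
  "(cfg a b)(1 := x) = cfg x b" "(cfg a b)(Suc 0 := x) = cfg x b" "(cfg a b)(2 := x) = cfg a x"
  by (auto simp: cfg_def fun_eq_iff)

lemma configs_2: "configs 2 = {cfg 0 0, cfg 1 0, cfg 0 1, cfg 1 1}"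
proof (intro subset_antisym subsetI)
  fix s assume s: "s \<in> configs 2"
  then have "s = cfg (s 1) (s 2)"
    unfolding configs_def cfg_def atLeastAtMost_1_2 by (auto simp: fun_eq_iff PiE_def extensional_def)
  moreover have "s 1 \<in> {0, 1}" "s 2 \<in> {0, 1}"
    using s by (auto simp: configs_def)
  ultimately show "s \<in> {cfg 0 0, cfg 1 0, cfg 0 1, cfg 1 1}"
    by (metis insertCI insertE singletonD)
qed (auto simp: configs_def cfg_def atLeastAtMost_1_2 PiE_iff extensional_def)

lemma in_config_cfg: "in_config 2 X t (cfg a b) \<omega> \<longleftrightarrow> X 1 t \<omega> = a \<and> X 2 t \<omega> = b"
  by (auto simp: in_config_def atLeastAtMost_1_2)

lemma transition_rate_cfg:
  "transition_rate 2 p q (cfg a b) (cfg a' b') =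
     (if a = 0 \<and> a' = 1 \<and> b' = b then p 1 + q 2 1 * real b else 0) +
     (if b = 0 \<and> b' = 1 \<and> a' = a then p 2 + q 1 2 * real a else 0)"
proof -
  have "{1, 2} - {1::nat} = {2}" "{1, 2} - {2::nat} = {1}" by auto
  then show ?thesis
    by (auto simp: transition_rate_def adoption_rate_def atLeastAtMost_1_2)
qed

locale bass_pair = bass \<Omega> 2 p q X
  for \<Omega> :: "'w measure" and p q X
begin

lemma prob_config_init: "prob_config 0 (cfg a b) = (if a = 0 \<and> b = 0 then 1 else 0)"
proof -
  have "{\<omega> \<in> space \<Omega>. in_config 2 X 0 (cfg a b) \<omega>} = (if a = 0 \<and> b = 0 then space \<Omega> else {})"
    using X_init by (auto simp: in_config_cfg)
  then show ?thesis by (simp add: prob_config_def prob_space)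
qed

text \<open>The system is triangular: nothing flows into \<open>cfg 0 0\<close>, and each
  one-adopter configuration is fed by \<open>cfg 0 0\<close> alone. The equations can be solved in
  this order.\<close>

lemma prob_flow_cfg:
  "prob_flow t (cfg 0 0) = - ((p 1 + p 2) * prob_config t (cfg 0 0))"
  "prob_flow t (cfg 1 0) = p 1 * prob_config t (cfg 0 0) - (p 2 + q 1 2) * prob_config t (cfg 1 0)"
  "prob_flow t (cfg 0 1) = p 2 * prob_config t (cfg 0 0) - (p 1 + q 2 1) * prob_config t (cfg 0 1)"
proof -
  have "configs 2 - {cfg 0 0} = {cfg 1 0, cfg 0 1, cfg 1 1}"
    "configs 2 - {cfg 1 0} = {cfg 0 0, cfg 0 1, cfg 1 1}"
    "configs 2 - {cfg 0 1} = {cfg 0 0, cfg 1 0, cfg 1 1}"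
    by (auto simp: configs_2)
  then show "prob_flow t (cfg 0 0) = - ((p 1 + p 2) * prob_config t (cfg 0 0))"
    "prob_flow t (cfg 1 0) = p 1 * prob_config t (cfg 0 0) - (p 2 + q 1 2) * prob_config t (cfg 1 0)"
    "prob_flow t (cfg 0 1) = p 2 * prob_config t (cfg 0 0) - (p 1 + q 2 1) * prob_config t (cfg 0 1)"
    unfolding prob_flow_def by (simp_all add: transition_rate_cfg algebra_simps)
qed

lemma prob_config_00:
  assumes "0 \<le> t"
  shows "prob_config t (cfg 0 0) = exp (- (p 1 + p 2) * t)"
proof (rule linear_ode_unique[where f = "\<lambda>_. 0" and c = "p 1 + p 2"
      and y = "\<lambda>t. prob_config t (cfg 0 0)"])
  fix t :: real assume "0 \<le> t"
  then show "((\<lambda>t. prob_config t (cfg 0 0)) has_real_derivative 0 - (p 1 + p 2) * prob_config t (cfg 0 0))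
      (at t within {0..})"
    using forward_equation[of "cfg 0 0" t] by (simp add: configs_2 prob_flow_cfg)
  show "((\<lambda>t. exp (- (p 1 + p 2) * t)) has_real_derivative 0 - (p 1 + p 2) * exp (- (p 1 + p 2) * t))
      (at t within {0..})"
    by (auto intro!: derivative_eq_intros simp: algebra_simps)
qed (use assms in \<open>simp_all add: prob_config_init\<close>)

text \<open>One formula serves both one-adopter configurations, with \<open>a\<close> the rate in
  and \<open>c\<close> the rate out. The condition on \<open>c\<close> excludes resonance with the
  decay rate of \<open>cfg 0 0\<close>, where the solution has another form.\<close>

lemma prob_config_one_adopter:
  assumes flow: "\<And>t. prob_flow t s = a * prob_config t (cfg 0 0) - c * prob_config t s"
    and s: "s \<in> {cfg 1 0, cfg 0 1}" and c: "c \<noteq> p 1 + p 2" and t: "0 \<le> t"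
  shows "prob_config t s = a / (c - (p 1 + p 2)) * (exp (- (p 1 + p 2) * t) - exp (- c * t))"
proof -
  \<comment> \<open>Writing \<open>a\<close> as \<open>k * (c - L)\<close> removes the division, so
    that checking the ansatz is pure ring arithmetic.\<close>
  define L k where "L = p 1 + p 2" and "k = a / (c - L)"
  have a: "a = k * (c - L)"
    using c by (simp add: L_def k_def)
  have "prob_config t s = k * (exp (- L * t) - exp (- c * t))"
  proof (rule linear_ode_unique[where f = "\<lambda>t. a * exp (- L * t)" and c = c
        and y = "\<lambda>t. prob_config t s"])
    fix t :: real assume "0 \<le> t"
    then show "((\<lambda>t. prob_config t s) has_real_derivative
        a * exp (- L * t) - c * prob_config t s) (at t within {0..})"
      using forward_equation[of s t] s flow by (auto simp: configs_2 prob_config_00 L_def)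
    show "((\<lambda>t. k * (exp (- L * t) - exp (- c * t))) has_real_derivative
        a * exp (- L * t) - c * (k * (exp (- L * t) - exp (- c * t)))) (at t within {0..})"
      unfolding a by (auto intro!: derivative_eq_intros simp: algebra_simps)
  qed (use s t prob_config_init in auto)
  then show ?thesis by (simp add: L_def k_def)
qed

lemmas prob_config_10 = prob_config_one_adopter[OF prob_flow_cfg(2)]
  and prob_config_01 = prob_config_one_adopter[OF prob_flow_cfg(3)]

text \<open>Nonadopters are counted instead of adopters: two in \<open>cfg 0 0\<close>, one in each
  one-adopter configuration. Only the three probabilities already solved for appear.\<close>

lemma adopter_fraction_eq:
  assumes "0 \<le> t"
  shows "adopter_fraction \<Omega> 2 X t =
    1 - prob_config t (cfg 0 0) - (prob_config t (cfg 1 0) + prob_config t (cfg 0 1)) / 2"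
proof -
  define A where "A s = {\<omega> \<in> space \<Omega>. in_config 2 X t s \<omega>}" for s
  have [measurable]: "A s \<in> sets \<Omega>" for s
    unfolding A_def using in_config_measurable[OF assms] by simp
  have "(\<integral>\<omega>. (\<Sum>j\<in>{1..2}. real (X j t \<omega>)) \<partial>\<Omega>) =
      (\<integral>\<omega>. 2 - 2 * indicat_real (A (cfg 0 0)) \<omega> - indicat_real (A (cfg 1 0)) \<omega>
        - indicat_real (A (cfg 0 1)) \<omega> \<partial>\<Omega>)"
  proof (rule Bochner_Integration.integral_cong)
    fix \<omega> assume \<omega>: "\<omega> \<in> space \<Omega>"
    have "X 1 t \<omega> \<in> {0, 1}" "X 2 t \<omega> \<in> {0, 1}"
      using X_values[OF _ assms \<omega>] by auto
    then show "(\<Sum>j\<in>{1..2}. real (X j t \<omega>)) = 2 - 2 * indicat_real (A (cfg 0 0)) \<omega>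
        - indicat_real (A (cfg 1 0)) \<omega> - indicat_real (A (cfg 0 1)) \<omega>"
      using \<omega> unfolding atLeastAtMost_1_2 A_def by (auto simp: in_config_cfg indicator_def)
  qed simp
  also have "\<dots> = 2 - 2 * prob (A (cfg 0 0)) - prob (A (cfg 1 0)) - prob (A (cfg 0 1))"
    by (simp add: prob_space emeasure_eq_measure)
  finally show ?thesis
    by (simp add: adopter_fraction_def prob_config_def A_def field_simps)
qed

end

section \<open>Limits as the time step tends to 0\<close>

lemma tendsto_one_minus_exp_quotient: "((\<lambda>h. (1 - exp (- l * h)) / h) \<longlongrightarrow> (l::real)) (at_right 0)"
proof -
  have "((\<lambda>h. 1 - exp (- l * h)) has_real_derivative l) (at 0)"
    by (auto intro!: derivative_eq_intros)
  then have "((\<lambda>h. (1 - exp (- l * h)) / h) \<longlongrightarrow> l) (at 0)"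
    by (simp add: has_field_derivative_iff)
  then show ?thesis by (simp add: filterlim_at_split)
qed

text \<open>Bounds \<open>lo h\<close> and \<open>up h\<close> that do not involve \<open>t\<close>
  are what delivers uniformity in \<open>t\<close> for the constructed process.\<close>

lemma uniform_limit_squeeze:
  fixes f :: "'a \<Rightarrow> 'b \<Rightarrow> real"
  assumes "\<forall>\<^sub>F h in F. \<forall>t\<in>S. lo h \<le> f h t \<and> f h t \<le> up h"
    and lo: "(lo \<longlongrightarrow> L) F" and up: "(up \<longlongrightarrow> L) F"
  shows "uniform_limit S f (\<lambda>_. L) F"
proof (rule uniform_limitI)
  fix e :: real assume "e > 0"
  from tendstoD[OF lo this] tendstoD[OF up this] assms(1)
  show "\<forall>\<^sub>F h in F. \<forall>t\<in>S. dist (f h t) L < e"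
    by eventually_elim (fastforce simp: dist_real_def abs_less_iff)
qed

section \<open>Transfer to another sample space\<close>

text \<open>For nonmeasurable \<open>A\<close> the image is nonmeasurable as well, and both measures
  are 0 by convention; the identity thus covers arbitrary events.\<close>

lemma measure_embed_measure_image:
  assumes "inj f"
  shows "measure (embed_measure N f) (f ` A) = measure N A"
proof (cases "A \<in> sets N")
  case True
  then show ?thesis by (simp add: measure_def emeasure_embed_measure_image[OF assms])
next
  case False
  then have "f ` A \<notin> sets (embed_measure N f)"
    using assms by (auto simp: sets_embed_measure inj_image_eq_iff)
  then show ?thesis using False by (simp add: measure_notin_sets)
qed

lemma prob_embed_measure:
  assumes "inj f"
  shows "\<P>(\<omega> in embed_measure N f. Q (inv f \<omega>)) = \<P>(\<omega> in N. Q \<omega>)"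
proof -
  have "{\<omega> \<in> space (embed_measure N f). Q (inv f \<omega>)} = f ` {\<omega> \<in> space N. Q \<omega>}"
    using assms by (auto simp: space_embed_measure)
  then show ?thesis by (simp add: measure_embed_measure_image[OF assms])
qed

lemma cond_prob_embed_measure:
  assumes "inj f"
  shows "cond_prob (embed_measure N f) (\<lambda>\<omega>. P (inv f \<omega>)) (\<lambda>\<omega>. Q (inv f \<omega>)) = cond_prob N P Q"
  unfolding cond_prob_def prob_embed_measure[OF assms, of N Q]
    prob_embed_measure[OF assms, of N "\<lambda>\<omega>. P \<omega> \<and> Q \<omega>"] by (rule refl)

text \<open>The conditions on a process speak only of pointwise values, measurability and
  probabilities of events, all of which survive pulling back along \<open>inv f\<close>. This
  carries a construction on a convenient sample space to a prescribed one.\<close>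

lemma bass_process_embed_measure:
  assumes f: "inj f" and N: "bass_process N M p q X"
  shows "bass_process (embed_measure N f) M p q (\<lambda>j t \<omega>. X j t (inv f \<omega>))"
proof (rule bass_processI)
  interpret N: bass N M p q X by standard (rule N)
  have ic: "in_config M (\<lambda>j t \<omega>. X j t (inv f \<omega>)) = (\<lambda>t s \<omega>. in_config M X t s (inv f \<omega>))"
    by (simp add: in_config_def fun_eq_iff)
  have inv: "inv f \<omega> \<in> space N" if "\<omega> \<in> space (embed_measure N f)" for \<omega>
    using that f by (auto simp: space_embed_measure)
  show "prob_space (embed_measure N f)"
    using emeasure_embed_measure_image[OF f sets.top, of N]
    by (intro prob_spaceI) (simp add: space_embed_measure N.emeasure_space_1)
  show "(\<lambda>\<omega>. X j t (inv f \<omega>)) \<in> embed_measure N f \<rightarrow>\<^sub>M count_space UNIV"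
    if "j \<in> {1..M}" "0 \<le> t" for j t
    using f N.X_measurable[OF that] by (intro measurable_embed_measure1) simp
  show "X j t (inv f \<omega>) \<in> {0, 1}"
    if "j \<in> {1..M}" "0 \<le> t" "\<omega> \<in> space (embed_measure N f)" for j t \<omega>
    using that(1,2) inv[OF that(3)] by (rule N.X_values)
  show "X j 0 (inv f \<omega>) = 0"
    if "j \<in> {1..M}" "\<omega> \<in> space (embed_measure N f)" for j \<omega>
    using that(1) inv[OF that(2)] by (rule N.X_init)
  show "X j u (inv f \<omega>) = 1"
    if "j \<in> {1..M}" "0 \<le> t" "t \<le> u" "\<omega> \<in> space (embed_measure N f)" "X j t (inv f \<omega>) = 1" for j t u \<omega>
    using that(1-3) inv[OF that(4)] that(5) by (rule N.X_mono)
next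
  interpret N: bass N M p q X by standard (rule N)
  have ic: "in_config M (\<lambda>j t \<omega>. X j t (inv f \<omega>)) = (\<lambda>t s \<omega>. in_config M X t s (inv f \<omega>))"
    by (simp add: in_config_def fun_eq_iff)
  let ?in = "in_config M (\<lambda>j t \<omega>. X j t (inv f \<omega>))" and ?E = "embed_measure N f"
  fix T t u \<sigma> s s'
  assume *: "s \<in> configs M" "s' \<in> configs M" "finite T" "T \<subseteq> {0..<t}" "0 \<le> t" "t < u"
    "\<P>(\<omega> in ?E. ?in t s \<omega> \<and> (\<forall>r\<in>T. ?in r (\<sigma> r) \<omega>)) > 0"
  have "\<P>(\<omega> in N. in_config M X t s \<omega> \<and> (\<forall>r\<in>T. in_config M X r (\<sigma> r) \<omega>)) > 0"
    using *(7) unfolding ic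
    by (subst (asm) prob_embed_measure[OF f, of N "\<lambda>\<omega>. in_config M X t s \<omega> \<and> (\<forall>r\<in>T. in_config M X r (\<sigma> r) \<omega>)"])
  from N.markov[OF *(1-6) this]
  show "\<P>(\<omega> in ?E. ?in u s' \<omega> \<bar> ?in t s \<omega> \<and> (\<forall>r\<in>T. ?in r (\<sigma> r) \<omega>)) = \<P>(\<omega> in ?E. ?in u s' \<omega> \<bar> ?in t s \<omega>)"
    unfolding ic cond_prob_embed_measure[OF f, of N "in_config M X u s'" "in_config M X t s"]
      cond_prob_embed_measure[OF f, of N "in_config M X u s'"
        "\<lambda>\<omega>. in_config M X t s \<omega> \<and> (\<forall>r\<in>T. in_config M X r (\<sigma> r) \<omega>)"] .
next
  interpret N: bass N M p q X by standard (rule N)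
  have ic: "in_config M (\<lambda>j t \<omega>. X j t (inv f \<omega>)) = (\<lambda>t s \<omega>. in_config M X t s (inv f \<omega>))"
    by (simp add: in_config_def fun_eq_iff)
  have pr: "\<P>(\<omega> in embed_measure N f. in_config M X t s (inv f \<omega>)) = \<P>(\<omega> in N. in_config M X t s \<omega>)" for t s
    by (rule prob_embed_measure[OF f])
  have cp: "\<P>(\<omega> in embed_measure N f. in_config M X u s' (inv f \<omega>) \<bar> in_config M X t s (inv f \<omega>)) =
      \<P>(\<omega> in N. in_config M X u s' \<omega> \<bar> in_config M X t s \<omega>)" for t s u s'
    by (rule cond_prob_embed_measure[OF f])
  fix s s' assume "s \<in> configs M" "s' \<in> configs M - {s}"
  from N.transition_limit[OF this]
  show "uniform_limit {t. 0 \<le> t \<and> \<P>(\<omega> in embed_measure N f. in_config M (\<lambda>j t \<omega>. X j t (inv f \<omega>)) t s \<omega>) > 0}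
      (\<lambda>h t. \<P>(\<omega> in embed_measure N f. in_config M (\<lambda>j t \<omega>. X j t (inv f \<omega>)) (t + h) s' \<omega> \<bar>
        in_config M (\<lambda>j t \<omega>. X j t (inv f \<omega>)) t s \<omega>) / h)
      (\<lambda>t. transition_rate M p q s s') (at_right 0)"
    unfolding ic pr cp .
qed

section \<open>Construction for two nodes\<close>

text \<open>Without the values \<open>\<le> 0\<close>, which have probability 0, the initial condition holds at every point.\<close>

definition pos_exponential :: "real \<Rightarrow> real measure" where
  "pos_exponential l = restrict_space (density lborel (exponential_density l)) {0<..}"

lemma space_pos_exponential [simp]: "space (pos_exponential l) = {0<..}"
  by (simp add: pos_exponential_def space_restrict_space)

lemma sets_pos_exponential [measurable_cong]:
  "sets (pos_exponential l) = sets (restrict_space borel {0<..})"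
  unfolding pos_exponential_def by (rule sets_restrict_space_cong) simp

lemma measure_pos_exponential_greaterThan:
  assumes l: "0 < l" and t: "0 \<le> t"
  shows "measure (pos_exponential l) {t<..} = exp (- l * t)"
proof -
  interpret D: prob_space "density lborel (exponential_density l)"
    by (rule prob_space_exponential_density[OF l])
  have "distributed (density lborel (exponential_density l)) lborel (\<lambda>x. x) (exponential_density l)"
    using l by (auto simp: distributed_def distr_id2 exponential_density_nonneg)
  from D.exponential_distributedD_gt[OF this t l] show ?thesis
    using t unfolding pos_exponential_def
    by (subst measure_restrict_space) (auto simp: greaterThan_def mult.commute)
qed

lemma prob_space_pos_exponential:
  assumes "0 < l" shows "prob_space (pos_exponential l)"
proof -
  interpret D: prob_space "density lborel (exponential_density l)"
    by (rule prob_space_exponential_density[OF assms])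
  have "finite_measure (pos_exponential l)"
    unfolding pos_exponential_def using D.finite_measure_axioms by (rule finite_measure_restrict_space) simp
  then interpret finite_measure "pos_exponential l" .
  show ?thesis
    \<comment> \<open>The tail beyond 0 is the whole restricted space, so its value 1 is the total
      mass.\<close>
    using measure_pos_exponential_greaterThan[OF assms, of 0]
    by (intro prob_spaceI) (simp add: emeasure_eq_measure)
qed

locale pair_construction =
  fixes p :: "nat \<Rightarrow> real" and q :: "nat \<Rightarrow> nat \<Rightarrow> real"
  assumes p_pos: "0 < p 1" "0 < p 2" and q_nonneg: "0 \<le> q 1 2" "0 \<le> q 2 1"
begin

(* keeps configurations in the form cfg 1 1 *)
declare One_nat_def [simp del]

text \<open>
  \<open>S\<close> is the time of the first adoption, \<open>B\<close> tells whether node 1 is the first adopter, and the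
  other node adopts after the further time \<open>E / rate B\<close>.
\<close>

definition rate :: "bool \<Rightarrow> real" where
  "rate b = (if b then p 2 + q 1 2 else p 1 + q 2 1)"

text \<open>For two competing exponential clocks the winner is independent of the winning time and
  has these probabilities.\<close>

definition first_prob :: "bool \<Rightarrow> real" where
  "first_prob b = (if b then p 1 else p 2) / (p 1 + p 2)"

definition single :: "bool \<Rightarrow> nat \<Rightarrow> nat" where
  "single b = (if b then cfg 1 0 else cfg 0 1)"

text \<open>The delay is stored as a unit exponential and divided by \<open>rate\<close> only in
  \<open>state\<close>; so it can be independent of the coin although the rate depends on the
  coin.\<close>

definition rest :: "(real \<times> bool) measure" where
  "rest = pos_exponential 1 \<Otimes>\<^sub>M measure_pmf (bernoulli_pmf (first_prob True))"

definition N :: "(real \<times> real \<times> bool) measure" where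
  "N = pos_exponential (p 1 + p 2) \<Otimes>\<^sub>M rest"

definition S :: "real \<times> real \<times> bool \<Rightarrow> real" where "S = fst"
definition E :: "real \<times> real \<times> bool \<Rightarrow> real" where "E = fst \<circ> snd"
definition B :: "real \<times> real \<times> bool \<Rightarrow> bool" where "B = snd \<circ> snd"

definition state :: "real \<Rightarrow> real \<times> real \<times> bool \<Rightarrow> nat \<Rightarrow> nat" where
  "state t \<omega> = (if t < S \<omega> then cfg 0 0 else if t < S \<omega> + E \<omega> / rate (B \<omega>) then single (B \<omega>) else cfg 1 1)"

lemma rate_pos: "0 < rate b"
  using p_pos q_nonneg by (simp add: rate_def)

lemma first_prob: "0 < first_prob b" "first_prob True + first_prob False = 1"
  using p_pos by (auto simp: first_prob_def add_divide_distrib[symmetric])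

lemma first_prob_le_1: "first_prob b \<le> 1"
  using first_prob(1)[of True] first_prob(1)[of False] first_prob(2) by (cases b) simp_all

lemma measure_coin: "measure (measure_pmf (bernoulli_pmf (first_prob True))) {b} = first_prob b"
  using first_prob(1)[of True] first_prob_le_1[of True] first_prob(2)
  by (cases b) (simp_all add: measure_pmf_single)

section \<open>The product space and its coordinates\<close>

sublocale clock: prob_space "pos_exponential (p 1 + p 2)"
  using p_pos by (intro prob_space_pos_exponential) simp

sublocale delay: prob_space "pos_exponential 1"
  by (rule prob_space_pos_exponential) simp

sublocale delay_coin: pair_prob_space "pos_exponential 1" "measure_pmf (bernoulli_pmf (first_prob True))"
  ..

sublocale rest: prob_space rest
  unfolding rest_def by (rule delay_coin.prob_space_axioms)

sublocale clock_rest: pair_prob_space "pos_exponential (p 1 + p 2)" rest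
  ..

sublocale prob_space N
  unfolding N_def by (rule clock_rest.prob_space_axioms)

lemma space_rest: "space rest = {0<..} \<times> UNIV"
  by (simp add: rest_def space_pair_measure)

lemma space_N: "\<omega> \<in> space N \<longleftrightarrow> 0 < S \<omega> \<and> 0 < E \<omega>"
  by (cases \<omega>) (simp add: N_def rest_def space_pair_measure S_def E_def)

lemma measurable_pos_exponential [measurable]: "(\<lambda>x. x) \<in> pos_exponential l \<rightarrow>\<^sub>M borel"
  by (simp add: measurable_cong_sets[OF sets_pos_exponential refl] measurable_restrict_space1)

lemma S_measurable [measurable]: "S \<in> N \<rightarrow>\<^sub>M borel"
  unfolding N_def S_def by (rule measurable_compose[OF measurable_fst measurable_pos_exponential])

lemma E_rest_measurable [measurable]: "fst \<in> rest \<rightarrow>\<^sub>M borel"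
  unfolding rest_def by (rule measurable_compose[OF measurable_fst measurable_pos_exponential])

lemma B_rest_measurable [measurable]: "snd \<in> rest \<rightarrow>\<^sub>M count_space UNIV"
  unfolding rest_def by (rule measurable_compose[OF measurable_snd, of "\<lambda>x. x"]) simp

lemma E_measurable [measurable]: "E \<in> N \<rightarrow>\<^sub>M borel"
  unfolding N_def E_def comp_def by (rule measurable_compose[OF measurable_snd E_rest_measurable])

lemma B_measurable [measurable]: "B \<in> N \<rightarrow>\<^sub>M count_space UNIV"
  unfolding N_def B_def comp_def by (rule measurable_compose[OF measurable_snd B_rest_measurable])

lemma pos_exponential_events: "A \<in> sets borel \<Longrightarrow> {0<..} \<inter> A \<in> sets (pos_exponential l)"
  unfolding sets_pos_exponential sets_restrict_space by auto

section \<open>Joint law of first adoption time, first adopter and delay\<close>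

lemma prob_rest:
  assumes "0 \<le> e"
  shows "emeasure rest {y \<in> space rest. e < fst y \<and> snd y = b} = ennreal (exp (- e) * first_prob b)"
proof -
  have "{y \<in> space rest. e < fst y \<and> snd y = b} = {e<..} \<times> {b}"
    using assms by (auto simp: space_rest)
  moreover have "{e<..} \<in> sets (pos_exponential 1)"
    using pos_exponential_events[of "{e<..}" 1] assms by (simp add: Int_absorb1)
  ultimately show ?thesis
    using measure_pos_exponential_greaterThan[of 1 e] assms
    by (simp add: rest_def measure_pmf.emeasure_pair_measure_Times delay.emeasure_eq_measure
        measure_pmf.emeasure_eq_measure measure_coin ennreal_mult')
qed

text \<open>Fubini over the first adoption time \<open>s\<close>: each slice is an exponential tail
  times a coin probability. The threshold \<open>c\<close> may depend on \<open>s\<close>, since the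
  delay remaining at a given time does; the Borel set \<open>Z\<close> will later carry the observed
  past.\<close>

lemma emeasure_first_delay:
  assumes Z: "Z \<in> sets borel" and t: "\<And>s. s \<in> Z \<Longrightarrow> 0 < s \<Longrightarrow> 0 \<le> c s" and c: "c \<in> borel_measurable borel"
  shows "emeasure N {\<omega> \<in> space N. S \<omega> \<in> Z \<and> c (S \<omega>) < E \<omega> \<and> B \<omega> = b} =
    (\<integral>\<^sup>+ s. indicator Z s * ennreal (exp (- c s) * first_prob b) \<partial>pos_exponential (p 1 + p 2))"
proof -
  note Z [measurable] c [measurable]
  let ?A = "{\<omega> \<in> space N. S \<omega> \<in> Z \<and> c (S \<omega>) < E \<omega> \<and> B \<omega> = b}"
  have "?A \<in> sets N" by measurable
  then have "emeasure N ?A = (\<integral>\<^sup>+ s. emeasure rest (Pair s -` ?A) \<partial>pos_exponential (p 1 + p 2))"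
    unfolding N_def by (rule rest.emeasure_pair_measure_alt)
  also have "\<dots> = (\<integral>\<^sup>+ s. indicator Z s * ennreal (exp (- c s) * first_prob b) \<partial>pos_exponential (p 1 + p 2))"
  proof (rule nn_integral_cong)
    fix s assume "s \<in> space (pos_exponential (p 1 + p 2))"
    then have "Pair s -` ?A = (if s \<in> Z then {y \<in> space rest. c s < fst y \<and> snd y = b} else {})"
      by (auto simp: N_def space_pair_measure S_def E_def B_def)
    then show "emeasure rest (Pair s -` ?A) = indicator Z s * ennreal (exp (- c s) * first_prob b)"
      using prob_rest[of "c s" b] t \<open>s \<in> space _\<close> by simp
  qed
  finally show ?thesis .
qed


text \<open>Lack of memory of the delay, in the presence of any information
  \<open>S \<omega> \<in> Z\<close> on the first adoption time. Being still in the one-adopter state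
  at \<open>u\<close> means \<open>rate b * (u - S \<omega>) < E \<omega>\<close>.\<close>

lemma prob_first_delay_shift:
  assumes Z: "Z \<in> sets borel" and tu: "t \<le> u"
  shows "\<P>(\<omega> in N. S \<omega> \<in> Z \<and> S \<omega> \<le> t \<and> u < S \<omega> + E \<omega> / rate b \<and> B \<omega> = b) =
    exp (- rate b * (u - t)) * \<P>(\<omega> in N. S \<omega> \<in> Z \<and> S \<omega> \<le> t \<and> t < S \<omega> + E \<omega> / rate b \<and> B \<omega> = b)"
proof -
  let ?A = "\<lambda>u. {\<omega> \<in> space N. S \<omega> \<in> Z \<and> S \<omega> \<le> t \<and> u < S \<omega> + E \<omega> / rate b \<and> B \<omega> = b}"
  let ?f = "\<lambda>u s. indicator (Z \<inter> {..t}) s * ennreal (exp (- (rate b * (u - s))) * first_prob b)"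
  note Z [measurable]
  have A: "emeasure N (?A u) = (\<integral>\<^sup>+ s. ?f u s \<partial>pos_exponential (p 1 + p 2))" if "t \<le> u" for u
  proof -
    have "?A u = {\<omega> \<in> space N. S \<omega> \<in> Z \<inter> {..t} \<and> rate b * (u - S \<omega>) < E \<omega> \<and> B \<omega> = b}"
      using rate_pos[of b] by (auto simp: field_simps)
    then show ?thesis
      using that rate_pos[of b] by (simp only:) (rule emeasure_first_delay, auto)
  qed
  \<comment> \<open>Splitting \<open>u - s\<close> into \<open>u - t\<close> and
    \<open>t - s\<close> isolates a factor free of \<open>s\<close>, which leaves the
    integral.\<close>
  have f: "?f u s = ennreal (exp (- rate b * (u - t))) * ?f t s" for s
    using first_prob(1)[of b]
    by (auto simp: ennreal_mult'[symmetric] exp_add[symmetric] algebra_simps split: split_indicator)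
  have "?f t \<in> borel_measurable borel" by measurable
  then have "?f t \<in> borel_measurable (pos_exponential (p 1 + p 2))"
    by (rule measurable_compose[OF measurable_pos_exponential])
  then have "emeasure N (?A u) = ennreal (exp (- rate b * (u - t))) * emeasure N (?A t)"
    unfolding A[OF tu] A[OF order.refl] f by (rule nn_integral_cmult)
  then show ?thesis
    by (simp add: emeasure_eq_measure ennreal_mult'[symmetric])
qed

lemma prob_first_in_interval:
  assumes t: "0 \<le> t" "t \<le> u" and e: "0 \<le> e"
  shows "\<P>(\<omega> in N. t < S \<omega> \<and> S \<omega> \<le> u \<and> e < E \<omega> \<and> B \<omega> = b) =
    (exp (- (p 1 + p 2) * t) - exp (- (p 1 + p 2) * u)) * exp (- e) * first_prob b"
proof -
  let ?L = "p 1 + p 2"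
  have L: "0 < ?L" using p_pos by simp
  have events: "{x<..} \<in> sets (pos_exponential ?L)" if "0 \<le> x" for x
    using pos_exponential_events[of "{x<..}" ?L] that by (simp add: Int_absorb1)
  have "{t<..u} = {t<..} - {u<..}" by auto
  moreover have "0 \<le> u" using t by simp
  moreover have "{u<..} \<subseteq> {t<..}" using t by auto
  ultimately have "clock.prob {t<..u} = exp (- ?L * t) - exp (- ?L * u)"
    using t clock.finite_measure_Diff[OF events events, of t u]
    by (simp only: measure_pos_exponential_greaterThan[OF L])
  moreover have "{t<..u} \<in> sets (pos_exponential ?L)"
    unfolding \<open>{t<..u} = _\<close> using events t by auto
  moreover have "{\<omega> \<in> space N. t < S \<omega> \<and> S \<omega> \<le> u \<and> e < E \<omega> \<and> B \<omega> = b} =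
      {\<omega> \<in> space N. S \<omega> \<in> {t<..u} \<and> e < E \<omega> \<and> B \<omega> = b}"
    by auto
  ultimately have "emeasure N {\<omega> \<in> space N. t < S \<omega> \<and> S \<omega> \<le> u \<and> e < E \<omega> \<and> B \<omega> = b} =
      ennreal (exp (- ?L * t) - exp (- ?L * u)) * ennreal (exp (- e) * first_prob b)"
    using emeasure_first_delay[of "{t<..u}" "\<lambda>_. e" b] e
    by (simp add: nn_integral_multc clock.emeasure_eq_measure)
  moreover have "0 \<le> exp (- ?L * t) - exp (- ?L * u)"
    using t L by (simp add: mult_left_mono)
  ultimately show ?thesis
    using first_prob(1)[of b]
    by (simp add: emeasure_eq_measure ennreal_mult'[symmetric] mult.assoc)
qed

lemma prob_no_adopter:
  assumes "0 \<le> t"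
  shows "\<P>(\<omega> in N. t < S \<omega>) = exp (- (p 1 + p 2) * t)"
proof -
  have "{t<..} \<in> sets (pos_exponential (p 1 + p 2))"
    using pos_exponential_events[of "{t<..}" "p 1 + p 2"] assms by (simp add: Int_absorb1)
  moreover have "{\<omega> \<in> space N. t < S \<omega>} = {t<..} \<times> space rest"
    using assms by (auto simp: N_def space_pair_measure S_def)
  ultimately show ?thesis
    using measure_pos_exponential_greaterThan[of "p 1 + p 2" t] assms p_pos
    by (simp add: N_def measure_def rest.emeasure_pair_measure_Times rest.emeasure_space_1)
qed

section \<open>States of the constructed paths\<close>

lemma state_eq_iff:
  "state t \<omega> = cfg 0 0 \<longleftrightarrow> t < S \<omega>"
  "state t \<omega> = single b \<longleftrightarrow> S \<omega> \<le> t \<and> t < S \<omega> + E \<omega> / rate b \<and> B \<omega> = b"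
  "\<omega> \<in> space N \<Longrightarrow> state t \<omega> = cfg 1 1 \<longleftrightarrow> S \<omega> + E \<omega> / rate (B \<omega>) \<le> t"
proof -
  show "\<omega> \<in> space N \<Longrightarrow> state t \<omega> = cfg 1 1 \<longleftrightarrow> S \<omega> + E \<omega> / rate (B \<omega>) \<le> t"
  proof -
    assume "\<omega> \<in> space N"
    \<comment> \<open>A positive delay is essential here: otherwise the second adoption time could
      precede the first, while \<open>state\<close> tests \<open>t < S \<omega>\<close>
      first.\<close>
    then have "0 < E \<omega> / rate (B \<omega>)"
      using rate_pos by (simp add: space_N)
    then show ?thesis
      by (auto simp: state_def single_def simp del: divide_pos_pos)
  qed
qed (auto simp: state_def single_def)

lemma state_configs: "state t \<omega> \<in> configs 2"
  by (auto simp: state_def single_def configs_2)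

lemma configs_2_cases:
  assumes "s \<in> configs 2"
  obtains "s = cfg 0 0" | b where "s = single b" | "s = cfg 1 1"
proof -
  have "s \<in> {cfg 0 0, single True, single False, cfg 1 1}"
    using assms by (auto simp: configs_2 single_def)
  then show thesis using that by auto
qed

text \<open>Both sides are configurations of the form \<open>cfg a b\<close>, so agreement on the
  two nodes is equality.\<close>

lemma in_config_state:
  assumes "s \<in> configs 2"
  shows "in_config 2 (\<lambda>j t \<omega>. state t \<omega> j) t s \<omega> \<longleftrightarrow> state t \<omega> = s"
proof -
  have "s = cfg (s 1) (s 2)" "state t \<omega> = cfg (state t \<omega> 1) (state t \<omega> 2)"
    using assms state_configs[of t \<omega>] unfolding configs_2 by auto
  then have "state t \<omega> = s \<longleftrightarrow> state t \<omega> 1 = s 1 \<and> state t \<omega> 2 = s 2"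
    by (metis cfg_eq_iff)
  then show ?thesis
    by (simp add: in_config_def atLeastAtMost_1_2)
qed

lemma state_measurable [measurable]: "state t \<in> N \<rightarrow>\<^sub>M count_space UNIV"
  unfolding state_def rate_def single_def by measurable


section \<open>The Markov property\<close>

lemma single_eq_iff [simp]:
  "single b = single b' \<longleftrightarrow> b = b'" "single b \<noteq> cfg 0 0" "cfg 0 0 \<noteq> single b" "single b \<noteq> cfg 1 1" "cfg 1 1 \<noteq> single b"
  by (auto simp: single_def)

text \<open>Given the present, the earlier path is either fully known or a function of the first
  adoption time alone.\<close>

lemma state_before:
  assumes "r \<le> t"
  shows "state t \<omega> = cfg 0 0 \<Longrightarrow> state r \<omega> = cfg 0 0"
    and "state t \<omega> = single b \<Longrightarrow> state r \<omega> = (if S \<omega> \<le> r then single b else cfg 0 0)"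
  using assms by (auto simp: state_def split: if_splits)

lemma state_after_full:
  assumes "\<omega> \<in> space N" "t \<le> u" "state t \<omega> = cfg 1 1"
  shows "state u \<omega> = cfg 1 1"
  using assms by (simp add: state_eq_iff(3))

text \<open>By \<open>state_eq_iff(2)\<close> this says that the state at \<open>t\<close> is
  \<open>single b\<close> and that the first adoption time lies in \<open>Z\<close>; the past is
  encoded by \<open>Z\<close>.\<close>

abbreviation first_then :: "bool \<Rightarrow> real \<Rightarrow> real set \<Rightarrow> real \<times> real \<times> bool \<Rightarrow> bool" where
  "first_then b t Z \<omega> \<equiv> S \<omega> \<in> Z \<and> S \<omega> \<le> t \<and> t < S \<omega> + E \<omega> / rate b \<and> B \<omega> = b"

text \<open>The row of the transition matrix over a time span \<open>h\<close> that starts in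
  \<open>single b\<close>.\<close>

definition jump :: "bool \<Rightarrow> (nat \<Rightarrow> nat) \<Rightarrow> real \<Rightarrow> real" where
  "jump b s h = (if s = single b then exp (- rate b * h) else if s = cfg 1 1 then 1 - exp (- rate b * h) else 0)"

text \<open>Staying put is the memoryless shift, full adoption is its complement within the
  conditioning event, and nothing else can be reached. The factor \<open>jump b s (u - t)\<close> is
  the same for every \<open>Z\<close>.\<close>

lemma prob_jump_one:
  assumes Z: "Z \<in> sets borel" and tu: "t \<le> u" and s: "s \<in> configs 2"
  shows "\<P>(\<omega> in N. state u \<omega> = s \<and> first_then b t Z \<omega>) = jump b s (u - t) * \<P>(\<omega> in N. first_then b t Z \<omega>)"
proof -
  note Z [measurable]
  have one: "{\<omega> \<in> space N. state u \<omega> = single b \<and> first_then b t Z \<omega>} =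
      {\<omega> \<in> space N. S \<omega> \<in> Z \<and> S \<omega> \<le> t \<and> u < S \<omega> + E \<omega> / rate b \<and> B \<omega> = b}"
    using tu by (auto simp: state_eq_iff)
  consider "s = single b" | "s = cfg 1 1" | "s \<noteq> single b" "s \<noteq> cfg 1 1" by blast
  then show ?thesis
  proof cases
    case 1
    then show ?thesis
      using prob_first_delay_shift[OF Z tu, of b] by (simp add: one jump_def)
  next
    case 2
    have "{\<omega> \<in> space N. state u \<omega> = s \<and> first_then b t Z \<omega>} = {\<omega> \<in> space N. first_then b t Z \<omega>} -
        {\<omega> \<in> space N. state u \<omega> = single b \<and> first_then b t Z \<omega>}"
      unfolding 2 using tu by (auto simp: state_eq_iff)
    moreover have "{\<omega> \<in> space N. state u \<omega> = single b \<and> first_then b t Z \<omega>} \<subseteq> {\<omega> \<in> space N. first_then b t Z \<omega>}"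
      by auto
    moreover have "{\<omega> \<in> space N. state u \<omega> = single b \<and> first_then b t Z \<omega>} \<in> sets N"
      "{\<omega> \<in> space N. first_then b t Z \<omega>} \<in> sets N"
      by measurable
    ultimately have "\<P>(\<omega> in N. state u \<omega> = s \<and> first_then b t Z \<omega>) = \<P>(\<omega> in N. first_then b t Z \<omega>) -
        \<P>(\<omega> in N. state u \<omega> = single b \<and> first_then b t Z \<omega>)"
      by (simp only: finite_measure_Diff)
    then show ?thesis
      unfolding one prob_first_delay_shift[OF Z tu] using 2 by (simp add: jump_def algebra_simps)
  next
    case 3
    \<comment> \<open>From \<open>single b\<close> the path can neither return to
      \<open>cfg 0 0\<close> nor switch to the other one-adopter configuration.\<close>
    have "\<not> (state u \<omega> = s \<and> first_then b t Z \<omega>)" for \<omega>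
      using s tu
    proof (cases rule: configs_2_cases)
      case (2 b')
      with 3 show ?thesis by (auto simp: state_eq_iff)
    qed (use 3 tu in \<open>auto simp: state_eq_iff\<close>)
    then have "{\<omega> \<in> space N. state u \<omega> = s \<and> first_then b t Z \<omega>} = {}" by blast
    then show ?thesis using 3 by (simp only: jump_def measure_empty) simp
  qed
qed

abbreviation X :: "nat \<Rightarrow> real \<Rightarrow> real \<times> real \<times> bool \<Rightarrow> nat" where
  "X \<equiv> \<lambda>j t \<omega>. state t \<omega> j"

text \<open>If the state at \<open>t\<close> is \<open>single b\<close>, then at an earlier
  \<open>r\<close> it is \<open>single b\<close> or \<open>cfg 0 0\<close> according to whether
  \<open>S \<omega> \<le> r\<close>. Finitely many prescribed past configurations therefore amount
  to a Borel condition on \<open>S \<omega>\<close>.\<close>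

lemma history_one:
  assumes T: "finite T" "T \<subseteq> {0..<t}"
  obtains Z where "Z \<in> sets borel" "\<And>\<omega>. \<omega> \<in> space N \<Longrightarrow>
    state t \<omega> = single b \<and> (\<forall>r\<in>T. in_config 2 X r (\<sigma> r) \<omega>) \<longleftrightarrow> first_then b t Z \<omega>"
proof
  let ?Z = "{x :: real. \<forall>r\<in>T. \<forall>j\<in>{1..2}. (if x \<le> r then single b else cfg 0 0) j = \<sigma> r j}"
  have "{x \<in> space borel. \<forall>r\<in>T. \<forall>j\<in>{1..2}. (if x \<le> r then single b else cfg 0 0) j = \<sigma> r j} \<in> sets borel"
    using T(1) by measurable
  then show "?Z \<in> sets borel" by simp
  fix \<omega>
  have "in_config 2 X r (\<sigma> r) \<omega> \<longleftrightarrow> (\<forall>j\<in>{1..2}. (if S \<omega> \<le> r then single b else cfg 0 0) j = \<sigma> r j)"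
    if "state t \<omega> = single b" "r \<in> T" for r
  proof -
    have "r \<le> t" using T(2) that(2) by auto
    then show ?thesis
      by (simp only: in_config_def state_before(2)[OF _ that(1)])
  qed
  then show "state t \<omega> = single b \<and> (\<forall>r\<in>T. in_config 2 X r (\<sigma> r) \<omega>) \<longleftrightarrow> first_then b t ?Z \<omega>"
    unfolding state_eq_iff(2) by blast
qed

text \<open>\<open>Z\<close> has dropped out of the value: any two histories ending in
  \<open>single b\<close> predict the same future.\<close>

lemma cond_prob_one:
  assumes Z: "Z \<in> sets borel" and C: "\<And>\<omega>. \<omega> \<in> space N \<Longrightarrow> C \<omega> \<longleftrightarrow> first_then b t Z \<omega>"
    and pos: "\<P>(\<omega> in N. C \<omega>) > 0" and tu: "t \<le> u" and s: "s \<in> configs 2"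
  shows "\<P>(\<omega> in N. in_config 2 X u s \<omega> \<bar> C \<omega>) = jump b s (u - t)"
proof -
  have "{\<omega> \<in> space N. C \<omega>} = {\<omega> \<in> space N. first_then b t Z \<omega>}"
    "{\<omega> \<in> space N. in_config 2 X u s \<omega> \<and> C \<omega>} = {\<omega> \<in> space N. state u \<omega> = s \<and> first_then b t Z \<omega>}"
    using C in_config_state[OF s] by auto
  then show ?thesis
    using pos by (simp add: cond_prob_def prob_jump_one[OF Z tu s])
qed

lemma cond_prob_full:
  assumes C: "\<And>\<omega>. \<omega> \<in> space N \<Longrightarrow> C \<omega> \<Longrightarrow> state t \<omega> = cfg 1 1"
    and pos: "\<P>(\<omega> in N. C \<omega>) > 0" and tu: "t \<le> u" and s: "s \<in> configs 2"
  shows "\<P>(\<omega> in N. in_config 2 X u s \<omega> \<bar> C \<omega>) = (if s = cfg 1 1 then 1 else 0)"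
proof -
  have "state u \<omega> = cfg 1 1" if "\<omega> \<in> space N" "C \<omega>" for \<omega>
    using state_after_full[OF that(1) tu] C[OF that] by simp
  then have "{\<omega> \<in> space N. in_config 2 X u s \<omega> \<and> C \<omega>} = (if s = cfg 1 1 then {\<omega> \<in> space N. C \<omega>} else {})"
    using in_config_state[OF s] by auto
  then show ?thesis using pos by (simp add: cond_prob_def)
qed

text \<open>Three reasons, by present state: with no adopter the past is certain, with one adopter
  the delay is memoryless, and full adoption is absorbing.\<close>

lemma markov_state:
  assumes s: "s \<in> configs 2" "s' \<in> configs 2" and T: "finite T" "T \<subseteq> {0..<t}" and tu: "t < u"
    and pos: "\<P>(\<omega> in N. in_config 2 X t s \<omega> \<and> (\<forall>r\<in>T. in_config 2 X r (\<sigma> r) \<omega>)) > 0"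
  shows "\<P>(\<omega> in N. in_config 2 X u s' \<omega> \<bar> in_config 2 X t s \<omega> \<and> (\<forall>r\<in>T. in_config 2 X r (\<sigma> r) \<omega>))
    = \<P>(\<omega> in N. in_config 2 X u s' \<omega> \<bar> in_config 2 X t s \<omega>)"
proof -
  let ?C = "\<lambda>\<omega>. in_config 2 X t s \<omega> \<and> (\<forall>r\<in>T. in_config 2 X r (\<sigma> r) \<omega>)"
  have "{\<omega> \<in> space N. in_config 2 X t s \<omega>} \<in> sets N"
    unfolding in_config_state[OF s(1)] by measurable
  then have "\<P>(\<omega> in N. ?C \<omega>) \<le> \<P>(\<omega> in N. in_config 2 X t s \<omega>)"
    by (intro finite_measure_mono) auto
  then have pos': "\<P>(\<omega> in N. in_config 2 X t s \<omega>) > 0"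
    using pos by linarith
  have tu': "t \<le> u" using tu by simp
  show ?thesis
    using s(1)
  proof (cases rule: configs_2_cases)
    case 1
    have H: "?C \<omega> \<longleftrightarrow> in_config 2 X t s \<omega> \<and> (\<forall>r\<in>T. \<forall>j\<in>{1..2}. cfg 0 0 j = \<sigma> r j)" for \<omega>
    proof -
      have "in_config 2 X r (\<sigma> r) \<omega> \<longleftrightarrow> (\<forall>j\<in>{1..2}. cfg 0 0 j = \<sigma> r j)" if "in_config 2 X t s \<omega>" "r \<in> T" for r
      proof -
        have "r \<le> t" using T(2) that(2) by auto
        moreover have "state t \<omega> = cfg 0 0" using that(1) in_config_state[OF s(1)] 1 by simp
        ultimately show ?thesis by (simp only: in_config_def state_before(1))
      qed
      then show ?thesis by blast
    qed
    \<comment> \<open>The prescribed past either contradicts \<open>cfg 0 0\<close> and makes the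
      event empty, or adds nothing; positive probability rules out the former.\<close>
    have "\<forall>r\<in>T. \<forall>j\<in>{1..2}. cfg 0 0 j = \<sigma> r j"
    proof (rule ccontr)
      assume "\<not> ?thesis"
      then have "{\<omega> \<in> space N. ?C \<omega>} = {}" unfolding H by blast
      then show False using pos by (simp only: measure_empty)
    qed
    then have "?C = in_config 2 X t s" using H by blast
    then show ?thesis by (simp only:)
  next
    case (2 b)
    from history_one[OF T] obtain Z where Z: "Z \<in> sets borel" "\<And>\<omega>. \<omega> \<in> space N \<Longrightarrow>
        state t \<omega> = single b \<and> (\<forall>r\<in>T. in_config 2 X r (\<sigma> r) \<omega>) \<longleftrightarrow> first_then b t Z \<omega>" by blast
    have "\<P>(\<omega> in N. in_config 2 X u s' \<omega> \<bar> ?C \<omega>) = jump b s' (u - t)"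
      using Z(2) unfolding in_config_state[OF s(1)] 2 
      by (intro cond_prob_one[OF Z(1) _ _ tu' s(2)]) (use pos 2 in_config_state[OF s(1)] in auto)
    \<comment> \<open>Conditioning on the present alone is the case \<open>Z = UNIV\<close>.\<close>
    moreover have "\<P>(\<omega> in N. in_config 2 X u s' \<omega> \<bar> in_config 2 X t s \<omega>) = jump b s' (u - t)"
      by (rule cond_prob_one[OF sets.top _ pos' tu' s(2)])
        (simp only: in_config_state[OF s(1)], simp add: 2 state_eq_iff)
    ultimately show ?thesis by simp
  next
    case 3
    then show ?thesis
      using cond_prob_full[of ?C, OF _ pos tu' s(2)] cond_prob_full[of "in_config 2 X t s", OF _ pos' tu' s(2)]
        in_config_state[OF s(1)] by simp
  qed
qed

section \<open>Estimates for a short step out of the state without adopters\<close>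

lemma
  assumes t: "0 \<le> t" and h: "0 < h"
  defines "g \<equiv> (1 - exp (- (p 1 + p 2) * h)) * exp (- (p 1 + p 2) * t)"
  shows prob_first_jump_ge:
      "g * exp (- rate b * h) * first_prob b \<le> \<P>(\<omega> in N. state (t + h) \<omega> = single b \<and> t < S \<omega>)"
    and prob_first_jump_le:
      "\<P>(\<omega> in N. state (t + h) \<omega> = single b \<and> t < S \<omega>) \<le> g * first_prob b"
    and prob_two_jumps_le:
      "\<P>(\<omega> in N. state (t + h) \<omega> = cfg 1 1 \<and> t < S \<omega>) \<le>
        g * (\<Sum>b\<in>UNIV. first_prob b * (1 - exp (- rate b * h)))"
proof -
  \<comment> \<open>The first adoption falls in the step and is by \<open>b\<close>; for
    \<open>0 \<le> e\<close> this has probability \<open>g * exp (- e) * first_prob b\<close>, so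
    \<open>g\<close> is the probability of a first adoption in the step.\<close>
  define A where "A e b = {\<omega> \<in> space N. t < S \<omega> \<and> S \<omega> \<le> t + h \<and> e < E \<omega> \<and> B \<omega> = b}" for e b
  have A_sets [measurable]: "A e b \<in> sets N" for e b
    unfolding A_def by measurable
  have prob_A: "prob (A e b) = g * exp (- e) * first_prob b" if "0 \<le> e" for e b
    unfolding A_def using prob_first_in_interval[OF t _ that, of "t + h" b] h
    by (simp add: g_def algebra_simps exp_add[symmetric])
  have rh: "0 \<le> rate b * h" for b using rate_pos[of b] h by simp
  have delay: "rate b * h < E \<omega> \<Longrightarrow> h < E \<omega> / rate b" for b \<omega>
    using rate_pos[of b] by (simp add: field_simps)
  \<comment> \<open>A delay longer than the whole step keeps the second adoption out of it, giving
    the lower bound.\<close>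
  have "A (rate b * h) b \<subseteq> {\<omega> \<in> space N. state (t + h) \<omega> = single b \<and> t < S \<omega>}"
    using delay[of b] by (fastforce simp: A_def state_eq_iff)
  then have "prob (A (rate b * h) b) \<le> \<P>(\<omega> in N. state (t + h) \<omega> = single b \<and> t < S \<omega>)"
    by (rule finite_measure_mono) measurable
  then show "g * exp (- rate b * h) * first_prob b \<le> \<P>(\<omega> in N. state (t + h) \<omega> = single b \<and> t < S \<omega>)"
    using rh by (simp add: prob_A)
  have "{\<omega> \<in> space N. state (t + h) \<omega> = single b \<and> t < S \<omega>} \<subseteq> A 0 b"
    by (auto simp: A_def state_eq_iff space_N)
  then have "\<P>(\<omega> in N. state (t + h) \<omega> = single b \<and> t < S \<omega>) \<le> prob (A 0 b)"
    by (rule finite_measure_mono) measurable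
  then show "\<P>(\<omega> in N. state (t + h) \<omega> = single b \<and> t < S \<omega>) \<le> g * first_prob b"
    by (simp add: prob_A)
  \<comment> \<open>Two adoptions within the step force
    \<open>E \<omega> / rate (B \<omega>) < h\<close>, so \<open>E \<omega>\<close> lies between 0
    and \<open>rate b * h\<close> for the first adopter \<open>b\<close>.\<close>
  have "{\<omega> \<in> space N. state (t + h) \<omega> = cfg 1 1 \<and> t < S \<omega>} \<subseteq> (\<Union>b\<in>UNIV. A 0 b - A (rate b * h) b)"
  proof
    fix \<omega> assume "\<omega> \<in> {\<omega> \<in> space N. state (t + h) \<omega> = cfg 1 1 \<and> t < S \<omega>}"
    then have "\<omega> \<in> space N" "S \<omega> + E \<omega> / rate (B \<omega>) \<le> t + h" "t < S \<omega>"
      using state_eq_iff(3)[of \<omega> "t + h"] by auto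
    moreover from this have "0 < E \<omega> / rate (B \<omega>)"
      using rate_pos by (simp add: space_N)
    ultimately have "\<omega> \<in> A 0 (B \<omega>) - A (rate (B \<omega>) * h) (B \<omega>)"
      using delay[of "B \<omega>" \<omega>] by (auto simp: A_def space_N simp del: zero_less_divide_iff)
    then show "\<omega> \<in> (\<Union>b\<in>UNIV. A 0 b - A (rate b * h) b)" by blast
  qed
  then have "\<P>(\<omega> in N. state (t + h) \<omega> = cfg 1 1 \<and> t < S \<omega>) \<le> prob (\<Union>b\<in>UNIV. A 0 b - A (rate b * h) b)"
    by (rule finite_measure_mono) measurable
  also have "\<dots> \<le> (\<Sum>b\<in>UNIV. prob (A 0 b - A (rate b * h) b))"
    by (rule finite_measure_subadditive_finite) auto
  also have "\<dots> = (\<Sum>b\<in>UNIV. prob (A 0 b) - prob (A (rate b * h) b))"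
  proof (intro sum.cong finite_measure_Diff A_sets refl)
    fix b show "A (rate b * h) b \<subseteq> A 0 b"
      using rh[of b] by (auto simp: A_def)
  qed
  also have "\<dots> = g * (\<Sum>b\<in>UNIV. first_prob b * (1 - exp (- rate b * h)))"
    using rh by (simp add: prob_A sum_distrib_left algebra_simps)
  finally show "\<P>(\<omega> in N. state (t + h) \<omega> = cfg 1 1 \<and> t < S \<omega>) \<le>
      g * (\<Sum>b\<in>UNIV. first_prob b * (1 - exp (- rate b * h)))" .
qed

text \<open>The main work is the infinitesimal condition; the path conditions and the Markov
  property follow from the preceding lemmas.\<close>

lemma bass_process_state: "bass_process N 2 p q X"
proof (rule bass_processI)
  fix s s' assume s: "s \<in> configs 2" "s' \<in> configs 2 - {s}"
  then have s': "s' \<in> configs 2" by simp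
  let ?c = "\<lambda>h t. \<P>(\<omega> in N. in_config 2 X (t + h) s' \<omega> \<bar> in_config 2 X t s \<omega>)"
  let ?S = "{t. 0 \<le> t \<and> \<P>(\<omega> in N. in_config 2 X t s \<omega>) > 0}"
  let ?r = "transition_rate 2 p q s s'"
  \<comment> \<open>The bounds depend on \<open>h\<close> only; this is where uniformity in
    \<open>t\<close> comes from.\<close>
  have "\<exists>lo up. (\<forall>h>0. \<forall>t\<in>?S. lo h \<le> ?c h t / h \<and> ?c h t / h \<le> up h) \<and>
      (lo \<longlongrightarrow> ?r) (at_right 0) \<and> (up \<longlongrightarrow> ?r) (at_right 0)"
    using s(1)
  proof (cases rule: configs_2_cases)
    case 1
    define L where "L = p 1 + p 2"
    define g where "g h = 1 - exp (- L * h)" for h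
    \<comment> \<open>Conditioning on \<open>cfg 0 0\<close> means dividing by the probability
      \<open>exp (- L * t)\<close> of \<open>t < S \<omega>\<close>; this factor also occurs in the
      numerator estimates and cancels, removing \<open>t\<close>.\<close>
    have c: "?c h t = \<P>(\<omega> in N. state (t + h) \<omega> = s' \<and> t < S \<omega>) / exp (- L * t)"
      if "t \<in> ?S" for h t
      using that prob_no_adopter[of t] unfolding cond_prob_def in_config_state[OF s(1)] in_config_state[OF s']
      by (simp add: 1 state_eq_iff L_def)
    have g: "((\<lambda>h. g h / h) \<longlongrightarrow> L) (at_right 0)"
      unfolding g_def by (rule tendsto_one_minus_exp_quotient)
    show ?thesis
      using s'
    proof (cases rule: configs_2_cases)
      case 1
      then show ?thesis using s(2) \<open>s = cfg 0 0\<close> by simp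
    next
      case (2 b)
      have r: "?r = L * first_prob b"
        using p_pos by (auto simp: 1 2 transition_rate_cfg single_def first_prob_def L_def)
      show ?thesis
      proof (intro exI conjI allI impI ballI)
        fix h t :: real assume h: "h > 0" and t: "t \<in> ?S"
        have "g h * exp (- rate b * h) * first_prob b * exp (- L * t) \<le> \<P>(\<omega> in N. state (t + h) \<omega> = s' \<and> t < S \<omega>)"
          "\<P>(\<omega> in N. state (t + h) \<omega> = s' \<and> t < S \<omega>) \<le> g h * first_prob b * exp (- L * t)"
          using prob_first_jump_ge[of t h b] prob_first_jump_le[of t h b] h t
          unfolding 2 g_def L_def by (simp_all only: mem_Collect_eq ac_simps)
        then have "g h * exp (- rate b * h) * first_prob b \<le> ?c h t" "?c h t \<le> g h * first_prob b"
          unfolding c[OF t] by (simp_all only: pos_le_divide_eq pos_divide_le_eq exp_gt_zero)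
        then show "g h / h * exp (- rate b * h) * first_prob b \<le> ?c h t / h"
          "?c h t / h \<le> g h / h * first_prob b"
          using h by (simp_all add: field_simps)
      next
        show "((\<lambda>h. g h / h * exp (- rate b * h) * first_prob b) \<longlongrightarrow> ?r) (at_right 0)"
        proof -
          have "((\<lambda>h. exp (- rate b * h)) \<longlongrightarrow> 1) (at_right 0)"
            by (auto intro!: tendsto_eq_intros)
          from tendsto_mult[OF tendsto_mult[OF g this] tendsto_const] show ?thesis
            unfolding r by simp
        qed
        show "((\<lambda>h. g h / h * first_prob b) \<longlongrightarrow> ?r) (at_right 0)"
          unfolding r by (rule tendsto_mult[OF g tendsto_const])
      qed
    next
      case 3
      \<comment> \<open>Two adoptions in one step have rate 0: \<open>g h / h\<close> stays bounded
        near 0, while the probability of so short a delay tends to 0.\<close>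
      have r: "?r = 0"
        by (simp add: 1 3 transition_rate_cfg)
      show ?thesis
      proof (intro exI conjI allI impI ballI)
        fix h t :: real assume h: "h > 0" and t: "t \<in> ?S"
        have "\<P>(\<omega> in N. state (t + h) \<omega> = s' \<and> t < S \<omega>) \<le>
            g h * (\<Sum>b\<in>UNIV. first_prob b * (1 - exp (- rate b * h))) * exp (- L * t)"
          using prob_two_jumps_le[of t h] h t
          unfolding 3 g_def L_def by (simp only: mem_Collect_eq ac_simps)
        then have "?c h t \<le> g h * (\<Sum>b\<in>UNIV. first_prob b * (1 - exp (- rate b * h)))"
          unfolding c[OF t] by (simp only: pos_divide_le_eq exp_gt_zero)
        then show "?c h t / h \<le> g h / h * (\<Sum>b\<in>UNIV. first_prob b * (1 - exp (- rate b * h)))"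
          using h by (simp add: divide_right_mono)
        show "0 \<le> ?c h t / h"
          using h by (simp add: cond_prob_def)
      next
        show "((\<lambda>h. g h / h * (\<Sum>b\<in>UNIV. first_prob b * (1 - exp (- rate b * h)))) \<longlongrightarrow> ?r) (at_right 0)"
        proof -
          have "((\<lambda>h. \<Sum>b\<in>UNIV. first_prob b * (1 - exp (- rate b * h))) \<longlongrightarrow> 0) (at_right 0)"
            by (auto intro!: tendsto_eq_intros)
          from tendsto_mult[OF g this] show ?thesis
            unfolding r by (simp only: mult_zero_right)
        qed
      qed (simp add: r)
    qed
  next
    case (2 b)
    \<comment> \<open>Here lack of memory gives the exact value, free of \<open>t\<close>, so lower
      and upper bound coincide.\<close>
    have c: "?c h t = jump b s' h" if "h > 0" "t \<in> ?S" for h t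
    proof -
      have "in_config 2 X t s \<omega> \<longleftrightarrow> first_then b t UNIV \<omega>" for \<omega>
        unfolding in_config_state[OF s(1)] by (simp add: 2 state_eq_iff)
      with cond_prob_one[of UNIV "in_config 2 X t s" t b "t + h" s'] that s'
      show ?thesis by simp
    qed
    have "((\<lambda>h. jump b s' h / h) \<longlongrightarrow> ?r) (at_right 0)"
      using s'
    proof (cases rule: configs_2_cases)
      case 1
      then show ?thesis by (simp add: jump_def 2 transition_rate_cfg single_def)
    next
      case (2 b')
      then show ?thesis using s(2) \<open>s = single b\<close> by (auto simp: jump_def transition_rate_cfg single_def)
    next
      case 3
      then have "?r = rate b" by (simp add: 2 transition_rate_cfg single_def rate_def)
      then show ?thesis using tendsto_one_minus_exp_quotient[of "rate b"] 3 by (simp add: jump_def)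
    qed
    then show ?thesis using c by (intro exI[of _ "\<lambda>h. jump b s' h / h"]) simp
  next
    case 3
    have "?c h t = 0" if "h > 0" "t \<in> ?S" for h t
    proof -
      have "state t \<omega> = cfg 1 1" if "in_config 2 X t s \<omega>" for \<omega>
        using that in_config_state[OF s(1)] 3 by simp
      from cond_prob_full[of "in_config 2 X t s", OF this _ _ s', of "t + h"] that s(2) 3
      show ?thesis by auto
    qed
    moreover have "?r = 0"
      using s' 3 by (auto simp: configs_2 transition_rate_cfg)
    ultimately show ?thesis by (intro exI[of _ "\<lambda>_. 0"]) simp
  qed
  then obtain lo up where *: "\<And>h t. h > 0 \<Longrightarrow> t \<in> ?S \<Longrightarrow> lo h \<le> ?c h t / h \<and> ?c h t / h \<le> up h"
    "(lo \<longlongrightarrow> ?r) (at_right 0)" "(up \<longlongrightarrow> ?r) (at_right 0)" by blast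
  show "uniform_limit ?S (\<lambda>h t. ?c h t / h) (\<lambda>_. ?r) (at_right 0)"
    by (rule uniform_limit_squeeze[OF _ *(2,3)])
      (use * in \<open>auto intro!: eventually_mono[OF eventually_at_right_less]\<close>)
next
  fix T t u \<sigma> s s'
  show "s \<in> configs 2 \<Longrightarrow> s' \<in> configs 2 \<Longrightarrow> finite T \<Longrightarrow> T \<subseteq> {0..<t} \<Longrightarrow> 0 \<le> t \<Longrightarrow> t < u \<Longrightarrow>
      \<P>(\<omega> in N. in_config 2 X t s \<omega> \<and> (\<forall>r\<in>T. in_config 2 X r (\<sigma> r) \<omega>)) > 0 \<Longrightarrow>
      \<P>(\<omega> in N. in_config 2 X u s' \<omega> \<bar> in_config 2 X t s \<omega> \<and> (\<forall>r\<in>T. in_config 2 X r (\<sigma> r) \<omega>))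
      = \<P>(\<omega> in N. in_config 2 X u s' \<omega> \<bar> in_config 2 X t s \<omega>)"
    by (rule markov_state)
next
  fix j :: nat and t u \<omega> assume j: "j \<in> {1..2}"
  show "X j t \<omega> \<in> {0, 1}"
    using state_configs[of t \<omega>] j by (auto simp: configs_def)
  show "(\<lambda>\<omega>. X j t \<omega>) \<in> N \<rightarrow>\<^sub>M count_space UNIV"
    by (rule measurable_compose[OF state_measurable]) simp
  assume \<omega>: "\<omega> \<in> space N"
  then have "state 0 \<omega> = cfg 0 0" by (simp add: state_eq_iff space_N)
  then show "X j 0 \<omega> = 0" using j by (auto simp: cfg_def)
  assume tu: "t \<le> u" and X: "X j t \<omega> = 1"
  show "X j u \<omega> = 1"
    \<comment> \<open>Monotonicity is read backwards: the state at \<open>u\<close> restricts the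
      state at \<open>t\<close> to itself or \<open>cfg 0 0\<close>, unless it is full
      adoption.\<close>
    using state_configs[of u \<omega>]
  proof (cases rule: configs_2_cases)
    case 1
    then show ?thesis using state_before(1)[OF tu] X j by (auto simp: cfg_def)
  next
    case (2 b)
    then show ?thesis using state_before(2)[OF tu] X j by (auto simp: cfg_def split: if_splits)
  next
    case 3
    then show ?thesis using j by (auto simp: cfg_def)
  qed
qed (rule prob_space_axioms)

end

section \<open>The sign change\<close>

lemma bass_process_pair_exists:
  assumes "0 < p 1" "0 < p 2" "0 \<le> q 1 2" "0 \<le> q 2 1"
  shows "\<exists>(\<Omega> :: (nat \<Rightarrow> real) measure) X. bass_process \<Omega> 2 p q X"
proof -
  interpret pair_construction p q
    by standard (use assms in auto)
  \<comment> \<open>The three coordinates are stored at the arguments 0, 1 and 2, the coin as 0 or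
    1, which makes the coding injective.\<close>
  define f :: "real \<times> real \<times> bool \<Rightarrow> nat \<Rightarrow> real"
    where "f = (\<lambda>(s, e, b) n. if n = 0 then s else if n = 1 then e else of_bool b)"
  have "\<omega> = (f \<omega> 0, f \<omega> 1, f \<omega> 2 = 1)" for \<omega>
    by (cases \<omega>) (simp add: f_def)
  then have "inj f" by (metis injI)
  from bass_process_embed_measure[OF this bass_process_state] show ?thesis by blast
qed

text \<open>The existence clauses exclude a vacuous claim. The sign change itself is asserted for
  every pair of processes with these rates, on arbitrary sample spaces, because the forward
  equations determine the adopter fractions.\<close>

theorem corollary3:
  shows "\<exists>M p q. bass_network M p q \<and> \<not> homogeneous M p q \<and>
    (\<exists>(\<Omega> :: (nat \<Rightarrow> real) measure) X. bass_process \<Omega> M p q X) \<and>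
    (\<exists>(\<Omega> :: (nat \<Rightarrow> real) measure) Y. bass_process \<Omega> M (hom_p M p) (hom_q M q) Y) \<and>
    (\<forall>(\<Omega> :: 'a measure) X (\<Omega>' :: 'b measure) Y.
       bass_process \<Omega> M p q X \<longrightarrow> bass_process \<Omega>' M (hom_p M p) (hom_q M q) Y \<longrightarrow>
       changes_sign (\<lambda>t. adopter_fraction \<Omega> M X t - adopter_fraction \<Omega>' M Y t))"
proof -
  \<comment> \<open>All rates out of the one-adopter states (6 and 2, against 4 in the homogeneous
    network) differ from the common rate 3 out of \<open>cfg 0 0\<close>, so no resonance
    occurs.\<close>
  define p :: "nat \<Rightarrow> real" where "p = (\<lambda>j. if j = 1 then 2 else 1)"
  define q :: "nat \<Rightarrow> nat \<Rightarrow> real" where "q = (\<lambda>i j. if i = 1 then 5 else 0)"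
  have nodes: "{1, 2} - {1::nat} = {2}" "{1, 2} - {2::nat} = {1}" by auto
  have hom: "hom_p 2 p j = 3 / 2" "hom_q 2 q i j = 5 / 2" for i j
    by (simp_all add: hom_p_def hom_q_def atLeastAtMost_1_2 nodes p_def q_def)
  have "changes_sign (\<lambda>t. adopter_fraction \<Omega> 2 X t - adopter_fraction \<Omega>' 2 Y t)"
    if X: "bass_process \<Omega> 2 p q X" and Y: "bass_process \<Omega>' 2 (hom_p 2 p) (hom_q 2 q) Y"
    for \<Omega> :: "'a measure" and X and \<Omega>' :: "'b measure" and Y
  proof -
    interpret het: bass_pair \<Omega> p q X by standard (rule X)
    interpret hom: bass_pair \<Omega>' "hom_p 2 p" "hom_q 2 q" Y by standard (rule Y)
    define g where "g t = adopter_fraction \<Omega> 2 X t - adopter_fraction \<Omega>' 2 Y t" for t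
    \<comment> \<open>The rates are integers, so with \<open>x = exp (- t)\<close> the difference is
      a polynomial in \<open>x\<close>; the \<open>cfg 0 0\<close> terms cancel. Near
      \<open>x = 1\<close> it behaves like \<open>(1 - x)^2\<close>, near \<open>x = 0\<close> like
      \<open>- (x^2)\<close>.\<close>
    have g: "2 * g t = 3 * (x ^ 3 - x ^ 4) - 2 / 3 * (x ^ 3 - x ^ 6) - (x ^ 2 - x ^ 3)"
      if "0 \<le> t" "x = exp (- t)" for t x
    proof -
      have x: "exp (- (real n * t)) = x ^ n" for n
        using exp_of_nat_mult[of n "- t"] that(2) by simp
      have "exp (- (2 * t)) = x ^ 2" "exp (- (3 * t)) = x ^ 3" "exp (- (4 * t)) = x ^ 4" "exp (- (6 * t)) = x ^ 6"
        using x[of 2] x[of 3] x[of 4] x[of 6] by simp_all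
      note x = this
      have "het.prob_config t (cfg 0 0) = x ^ 3"
        using that(1) x by (simp add: het.prob_config_00 p_def)
      moreover have "hom.prob_config t (cfg 0 0) = x ^ 3"
        using that(1) x by (simp add: hom.prob_config_00 hom)
      moreover have "het.prob_config t (cfg 1 0) = 2 / 3 * (x ^ 3 - x ^ 6)"
        by (subst het.prob_config_10) (use that(1) x in \<open>simp_all add: p_def q_def\<close>)
      moreover have "het.prob_config t (cfg 0 1) = x ^ 2 - x ^ 3"
        by (subst het.prob_config_01) (use that(1) x in \<open>simp_all add: p_def q_def\<close>)
      moreover have "hom.prob_config t (cfg 1 0) = 3 / 2 * (x ^ 3 - x ^ 4)"
        by (subst hom.prob_config_10) (use that(1) x in \<open>simp_all add: hom\<close>)
      moreover have "hom.prob_config t (cfg 0 1) = 3 / 2 * (x ^ 3 - x ^ 4)"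
        by (subst hom.prob_config_01) (use that(1) x in \<open>simp_all add: hom\<close>)
      ultimately show ?thesis
        unfolding g_def het.adopter_fraction_eq[OF that(1)] hom.adopter_fraction_eq[OF that(1)]
        by (simp only:) (simp add: field_simps)
    qed
    \<comment> \<open>Sample points with rational \<open>x\<close>: \<open>4/5\<close>, close enough
      to 1 for a positive value, and then \<open>1/2\<close>, where the value is already
      negative.\<close>
    have "2 * g (ln (5 / 4)) = 3 * ((4/5) ^ 3 - (4/5) ^ 4) - 2 / 3 * ((4/5) ^ 3 - (4/5) ^ 6) - ((4/5) ^ 2 - (4/5) ^ 3)"
      by (rule g) (simp_all add: exp_minus)
    then have "g (ln (5 / 4)) > 0" by (simp add: power_divide)
    moreover have "2 * g (ln 2) = 3 * ((1/2) ^ 3 - (1/2) ^ 4) - 2 / 3 * ((1/2) ^ 3 - (1/2) ^ 6) - ((1/2) ^ 2 - (1/2) ^ 3)"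
      by (rule g) (simp_all add: exp_minus)
    then have "g (ln 2) < 0" by (simp add: power_divide)
    ultimately have "changes_sign g"
      unfolding changes_sign_def by (intro conjI exI[of _ "ln (5 / 4)"] exI[of _ "ln 2"]) auto
    then show ?thesis by (simp add: g_def[abs_def])
  qed
  moreover have "bass_network 2 p q"
    by (auto simp: bass_network_def p_def q_def)
  moreover have "\<not> homogeneous 2 p q"
    by (auto simp: homogeneous_def p_def atLeastAtMost_1_2)
  moreover have "\<exists>(\<Omega> :: (nat \<Rightarrow> real) measure) X. bass_process \<Omega> 2 p q X"
    by (rule bass_process_pair_exists) (simp_all add: p_def q_def)
  moreover have "\<exists>(\<Omega> :: (nat \<Rightarrow> real) measure) Y. bass_process \<Omega> 2 (hom_p 2 p) (hom_q 2 q) Y"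
    by (rule bass_process_pair_exists) (simp_all add: hom)
  ultimately show ?thesis by blast
qed

end
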